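(* Let $k\ge 1$, let $G_k$ be the group of $k$-jets at $0$ of reparametrizations of $(\mathbb{C},0)$, with Lie algebra $\mathfrak{g}_k$, on which $G_k$ acts by the adjoint action. Let $\mathfrak{g}_k/\!/G_k=\mathrm{Spec}(\mathbb{C}[\mathfrak{g}_k]^{G_k})$ and let $\pi:\mathfrak{g}_k\to\mathfrak{g}_k/\!/G_k$ be the quotient morphism. Then: 1. $\mathbb{C}[\mathfrak{g}_k]^{G_k}$ is a polynomial algebra. 2. $\max_{x\in\mathfrak{g}_k}\dim G_k.x=\dim\mathfrak{g}_k-\dim\mathfrak{g}_k/\!/G_k$. 3. The quotient map $\pi$ is equidimensional. 4. If $\Omega=\{x\in\mathfrak{g}_k\mid d_x\pi\text{ is onto}\}$, then $\mathfrak{g}_k\setminus\Omega$ contains no divisor. 5. The null cone $\pi^{-1}\pi(0)$ is an irreducible complete intersection of dimension $\dim\mathfrak{g}_k-\dim\mathfrak{g}_k/\!/G_k$.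
   Context: $G_k\subset GL_k(\mathbb{C})$ is the complex algebraic group of all upper triangular $k\times k$ matrices $A(a_1,\dots,a_k)$, $a_1\in\mathbb{C}^*$, $a_2,\dots,a_k\in\mathbb{C}$, with entries $A_{ij}=\sum_{s_1+\cdots+s_i=j,\ s_l\ge 1} a_{s_1}\cdots a_{s_i}$. It corresponds to the group of reparametrizations $t\mapsto a_1t+a_2t^2+\cdots+a_kt^k$ modulo $t^{k+1}$. The quotient morphism $\pi$ is the morphism corresponding to the inclusion $\mathbb{C}[\mathfrak{g}_k]^{G_k}\hookrightarrow\mathbb{C}[\mathfrak{g}_k]$. Equidimensional means that all fibers have the same dimension. *)

theory Defs
  imports
    "HOL-Analysis.Abstract_Topology"
    "HOL-Library.Extended_Real"
    "HOL-Library.FuncSet"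
    "HOL-Library.Poly_Mapping"
    "HOL-Algebra.QuotRing"
    "HOL-Algebra.Group_Action"
    "Jordan_Normal_Form.Matrix"
begin

section \<open>Dimension and irreducibility\<close>

definition irreducible_in :: "'a topology \<Rightarrow> 'a set \<Rightarrow> bool" where
  "irreducible_in X S \<longleftrightarrow> S \<subseteq> topspace X \<and> S \<noteq> {} \<and>
     (\<forall>A B. closedin X A \<and> closedin X B \<and> S \<subseteq> A \<union> B \<longrightarrow> S \<subseteq> A \<or> S \<subseteq> B)"

text \<open>Supremum of the lengths of chains \<open>Z 0 \<subset> \<dots> \<subset> Z n\<close> of irreducible closed sets; the empty
  space has dimension \<open>-\<infinity>\<close>.\<close>
definition krull_dim :: "'a topology \<Rightarrow> ereal" where
  "krull_dim X = Sup {ereal (real n) | n. \<exists>Z :: nat \<Rightarrow> 'a set.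
     (\<forall>i\<le>n. closedin X (Z i) \<and> irreducible_in X (Z i)) \<and> (\<forall>i<n. Z i \<subset> Z (Suc i))}"

section \<open>Algebras of functions and their spectra\<close>

text \<open>The algebra of complex functions on \<open>S\<close> with underlying set \<open>F\<close>. Functions on \<open>S\<close> are
  extensional (\<open>undefined\<close> off \<open>S\<close>), so that equality is equality on \<open>S\<close>.\<close>
definition fun_alg :: "'p set \<Rightarrow> ('p \<Rightarrow> complex) set \<Rightarrow> ('p \<Rightarrow> complex) ring" where
  "fun_alg S F = \<lparr>carrier = F,
     monoid.mult = (\<lambda>f g. \<lambda>x\<in>S. f x * g x), one = (\<lambda>x\<in>S. 1),
     zero = (\<lambda>x\<in>S. 0), add = (\<lambda>f g. \<lambda>x\<in>S. f x + g x)\<rparr>"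

definition spec :: "('a, 'm) ring_scheme \<Rightarrow> 'a set set" where
  "spec R = {P. primeideal P R}"

definition spec_topology :: "('a, 'm) ring_scheme \<Rightarrow> 'a set topology" where
  "spec_topology R = topology (\<lambda>U. \<exists>E\<subseteq>carrier R. U = {P \<in> spec R. \<not> E \<subseteq> P})"

definition closed_points :: "('a, 'm) ring_scheme \<Rightarrow> 'a set set" where
  "closed_points R = {P. maximalideal P R}"

text \<open>The Zariski tangent space at the closed point given by evaluation at \<open>x\<close>: the
  \<open>\<complex>\<close>-linear derivations \<open>F \<rightarrow> \<complex>\<close> over evaluation at \<open>x\<close>, that is, the dual of \<open>m / m\<^sup>2\<close> for
  \<open>m = {f \<in> F. f x = 0}\<close>. It depends on \<open>x\<close> only through \<open>m\<close>.\<close>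
definition tangent_space ::
  "'p set \<Rightarrow> ('p \<Rightarrow> complex) set \<Rightarrow> 'p \<Rightarrow> (('p \<Rightarrow> complex) \<Rightarrow> complex) set" where
  "tangent_space S F x = {D \<in> extensional F.
     (\<forall>f\<in>F. \<forall>g\<in>F. D (\<lambda>y\<in>S. f y + g y) = D f + D g) \<and>
     (\<forall>c. \<forall>f\<in>F. D (\<lambda>y\<in>S. c * f y) = c * D f) \<and>
     (\<forall>f\<in>F. \<forall>g\<in>F. D (\<lambda>y\<in>S. f y * g y) = f x * D g + g x * D f)}"

text \<open>The polynomial ring \<open>\<complex>[y\<^sub>0, \<dots>, y\<^sub>n\<^sub>-\<^sub>1]\<close>: finitely supported functions from monomials
  \<open>nat \<Rightarrow>\<^sub>0 nat\<close> to coefficients, with the convolution product.\<close>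
definition poly_ring :: "nat \<Rightarrow> ((nat \<Rightarrow>\<^sub>0 nat) \<Rightarrow>\<^sub>0 complex) ring" where
  "poly_ring n = \<lparr>carrier = {p. \<forall>m \<in> Poly_Mapping.keys p. Poly_Mapping.keys m \<subseteq> {..<n}},
     monoid.mult = (*), one = 1, zero = 0, add = (+)\<rparr>"

text \<open>\<open>\<iota>\<close> is the structure map of the \<open>\<complex>\<close>-algebra \<open>R\<close>.\<close>
definition is_polynomial_algebra :: "('a, 'm) ring_scheme \<Rightarrow> (complex \<Rightarrow> 'a) \<Rightarrow> bool" where
  "is_polynomial_algebra R \<iota> \<longleftrightarrow>
     (\<exists>n. \<exists>\<phi> \<in> ring_iso (poly_ring n) R. \<forall>c. \<phi> (Poly_Mapping.single 0 c) = \<iota> c)"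

section \<open>Subvarieties of the affine space of matrices\<close>

inductive_set mat_poly_funs :: "nat \<Rightarrow> (complex mat \<Rightarrow> complex) set" for k :: nat where
  const: "(\<lambda>X. c) \<in> mat_poly_funs k"
| entry: "i < k \<Longrightarrow> j < k \<Longrightarrow> (\<lambda>X. X $$ (i, j)) \<in> mat_poly_funs k"
| add: "f \<in> mat_poly_funs k \<Longrightarrow> g \<in> mat_poly_funs k \<Longrightarrow> (\<lambda>X. f X + g X) \<in> mat_poly_funs k"
| mult: "f \<in> mat_poly_funs k \<Longrightarrow> g \<in> mat_poly_funs k \<Longrightarrow> (\<lambda>X. f X * g X) \<in> mat_poly_funs k"

definition coord_funs :: "nat \<Rightarrow> complex mat set \<Rightarrow> (complex mat \<Rightarrow> complex) set" where
  "coord_funs k S = (\<lambda>f. restrict f S) ` mat_poly_funs k"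

definition zariski :: "nat \<Rightarrow> complex mat set \<Rightarrow> complex mat topology" where
  "zariski k S = topology (\<lambda>U. \<exists>F\<subseteq>coord_funs k S. U = {x \<in> S. \<exists>f\<in>F. f x \<noteq> 0})"

definition vanishing_ideal ::
  "nat \<Rightarrow> complex mat set \<Rightarrow> complex mat set \<Rightarrow> (complex mat \<Rightarrow> complex) set" where
  "vanishing_ideal k S Z = {f \<in> coord_funs k S. \<forall>z\<in>Z. f z = 0}"

text \<open>A closed subvariety \<open>Z\<close> of the affine space \<open>S\<close> is a complete intersection if its ideal
  is generated by as many elements as its codimension.\<close>
definition complete_intersection :: "nat \<Rightarrow> complex mat set \<Rightarrow> complex mat set \<Rightarrow> bool" where
  "complete_intersection k S Z \<longleftrightarrow> closedin (zariski k S) Z \<and>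
     (\<exists>F. finite F \<and> F \<subseteq> coord_funs k S \<and>
        ereal (real (card F)) = krull_dim (zariski k S) - krull_dim (subtopology (zariski k S) Z) \<and>
        vanishing_ideal k S Z = Idl\<^bsub>fun_alg S (coord_funs k S)\<^esub> F)"

definition prime_divisor :: "nat \<Rightarrow> complex mat set \<Rightarrow> complex mat set \<Rightarrow> bool" where
  "prime_divisor k S Z \<longleftrightarrow> closedin (zariski k S) Z \<and> irreducible_in (zariski k S) Z \<and>
     krull_dim (subtopology (zariski k S) Z) = krull_dim (zariski k S) - 1"

section \<open>The group of jets of reparametrizations and its adjoint quotient\<close>

text \<open>\<open>A(a\<^sub>1, \<dots>, a\<^sub>k)\<close>; the entry in row \<open>i\<close> and column \<open>j\<close> (counted from 1) is the coefficient of
  \<open>t\<^sup>j\<close> in \<open>(a\<^sub>1 t + a\<^sub>2 t\<^sup>2 + \<dots>)\<^sup>i\<close>. Matrix indices of the library start at 0, hence the shifts.\<close>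
definition jet_mat :: "nat \<Rightarrow> (nat \<Rightarrow> complex) \<Rightarrow> complex mat" where
  "jet_mat k a = mat k k (\<lambda>(i, j).
     \<Sum>s \<in> {s :: nat list. length s = i + 1 \<and> sum_list s = j + 1 \<and> (\<forall>l \<in> set s. 1 \<le> l)}.
       prod_list (map a s))"

definition jet_group :: "nat \<Rightarrow> complex mat monoid" where
  "jet_group k = \<lparr>carrier = {jet_mat k a | a. a 1 \<noteq> 0}, monoid.mult = (*), one = 1\<^sub>m k\<rparr>"

text \<open>The tangent space of the group at the identity, a derivation \<open>D\<close> being identified with the
  matrix of its values on the coordinate functions. Polynomial functions in the entries suffice
  although \<open>\<complex>[G\<^sub>k]\<close> also contains \<open>1 / det\<close>: point derivations extend uniquely to this
  localization.\<close>
definition jet_lie :: "nat \<Rightarrow> complex mat set" where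
  "jet_lie k = {mat k k (\<lambda>(i, j). D (\<lambda>X\<in>carrier (jet_group k). X $$ (i, j))) | D.
     D \<in> tangent_space (carrier (jet_group k)) (coord_funs k (carrier (jet_group k))) (1\<^sub>m k)}"

definition Ad :: "nat \<Rightarrow> complex mat \<Rightarrow> complex mat \<Rightarrow> complex mat" where
  "Ad k A X = A * X * inv\<^bsub>jet_group k\<^esub> A"

abbreviation jet_orbit :: "nat \<Rightarrow> complex mat \<Rightarrow> complex mat set" where
  "jet_orbit k x \<equiv> orbit (jet_group k) (Ad k) x"

definition inv_funs :: "nat \<Rightarrow> (complex mat \<Rightarrow> complex) set" where
  "inv_funs k = {f \<in> coord_funs k (jet_lie k).
     \<forall>A \<in> carrier (jet_group k). \<forall>x \<in> jet_lie k. f (Ad k A x) = f x}"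

definition inv_alg :: "nat \<Rightarrow> (complex mat \<Rightarrow> complex) ring" where
  "inv_alg k = fun_alg (jet_lie k) (inv_funs k)"

text \<open>On closed points the morphism of spectra induced by the inclusion of the invariants is the
  contraction of the maximal ideal of \<open>x\<close>.\<close>
definition quot_map :: "nat \<Rightarrow> complex mat \<Rightarrow> (complex mat \<Rightarrow> complex) set" where
  "quot_map k x = {f \<in> coord_funs k (jet_lie k). f x = 0} \<inter> inv_funs k"

definition fibre :: "nat \<Rightarrow> (complex mat \<Rightarrow> complex) set \<Rightarrow> complex mat set" where
  "fibre k y = {x \<in> jet_lie k. quot_map k x = y}"

definition null_cone :: "nat \<Rightarrow> complex mat set" where
  "null_cone k = fibre k (quot_map k (0\<^sub>m k k))"

definition quot_diff ::
  "nat \<Rightarrow> ((complex mat \<Rightarrow> complex) \<Rightarrow> complex) \<Rightarrow> ((complex mat \<Rightarrow> complex) \<Rightarrow> complex)" where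
  "quot_diff k D = restrict D (inv_funs k)"

definition submersive_points :: "nat \<Rightarrow> complex mat set" where
  "submersive_points k = {x \<in> jet_lie k.
     quot_diff k ` tangent_space (jet_lie k) (coord_funs k (jet_lie k)) x =
       tangent_space (jet_lie k) (inv_funs k) x}"

abbreviation dim_lie :: "nat \<Rightarrow> ereal" where
  "dim_lie k \<equiv> krull_dim (zariski k (jet_lie k))"

abbreviation dim_sub :: "nat \<Rightarrow> complex mat set \<Rightarrow> ereal" where
  "dim_sub k Z \<equiv> krull_dim (subtopology (zariski k (jet_lie k)) Z)"

abbreviation dim_quot :: "nat \<Rightarrow> ereal" where
  "dim_quot k \<equiv> krull_dim (spec_topology (inv_alg k))"

section \<open>The Zariski topologies are topologies\<close>

lemma istopology_zariski:
  "istopology (\<lambda>U. \<exists>F\<subseteq>coord_funs k S. U = {x \<in> S. \<exists>f\<in>F. f x \<noteq> 0})"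
proof -
  have *: "\<exists>F\<subseteq>coord_funs k S. U \<inter> V = {x \<in> S. \<exists>f\<in>F. f x \<noteq> 0}"
    if F: "F \<subseteq> coord_funs k S" "U = {x \<in> S. \<exists>f\<in>F. f x \<noteq> 0}"
    and G: "G \<subseteq> coord_funs k S" "V = {x \<in> S. \<exists>f\<in>G. f x \<noteq> 0}" for U V F G
  proof (intro exI conjI)
    have "(\<lambda>x\<in>S. f x * g x) \<in> coord_funs k S"
      if fg: "f \<in> coord_funs k S" "g \<in> coord_funs k S" for f g
    proof -
      obtain p q where pq: "p \<in> mat_poly_funs k" "q \<in> mat_poly_funs k"
        and f: "f = restrict p S" and g: "g = restrict q S"
        using fg by (auto simp: coord_funs_def)
      have "(\<lambda>x\<in>S. f x * g x) = restrict (\<lambda>x. p x * q x) S"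
        by (auto simp: f g)
      then show ?thesis
        using mat_poly_funs.mult[OF pq] by (auto simp: coord_funs_def)
    qed
    then show "{(\<lambda>x\<in>S. f x * g x) | f g. f \<in> F \<and> g \<in> G} \<subseteq> coord_funs k S"
      using F(1) G(1) by auto
    show "U \<inter> V = {x \<in> S. \<exists>h\<in>{(\<lambda>x\<in>S. f x * g x) | f g. f \<in> F \<and> g \<in> G}. h x \<noteq> 0}"
      unfolding F(2) G(2) by fastforce
  qed
  have **: "\<exists>F\<subseteq>coord_funs k S. \<Union>\<U> = {x \<in> S. \<exists>f\<in>F. f x \<noteq> 0}"
    if \<U>: "\<forall>U\<in>\<U>. \<exists>F\<subseteq>coord_funs k S. U = {x \<in> S. \<exists>f\<in>F. f x \<noteq> 0}" for \<U>
  proof -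
    obtain F where F: "\<forall>U\<in>\<U>. F U \<subseteq> coord_funs k S \<and> U = {x \<in> S. \<exists>f\<in>F U. f x \<noteq> 0}"
      using bchoice[OF \<U>] ..
    have sub: "\<Union>(F ` \<U>) \<subseteq> coord_funs k S"
      using F by (simp add: UN_least)
    have mem: "x \<in> U \<longleftrightarrow> x \<in> {x \<in> S. \<exists>f\<in>F U. f x \<noteq> 0}" if "U \<in> \<U>" for x U
      using F that by (metis (lifting))
    have "\<Union>\<U> = {x \<in> S. \<exists>f\<in>\<Union>(F ` \<U>). f x \<noteq> 0}"
      unfolding set_eq_iff Union_iff using mem by blast
    with sub show ?thesis
      by blast
  qed
  show ?thesis
    unfolding istopology_def by (intro conjI allI impI; (elim exE conjE)?; (rule * **; assumption)?)
qed

lemma istopology_spec: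
  "istopology (\<lambda>U. \<exists>E\<subseteq>carrier R. U = {P \<in> spec R. \<not> E \<subseteq> P})"
proof -
  have *: "\<exists>E\<subseteq>carrier R. U \<inter> V = {P \<in> spec R. \<not> E \<subseteq> P}"
    if E: "E \<subseteq> carrier R" "U = {P \<in> spec R. \<not> E \<subseteq> P}"
    and G: "G \<subseteq> carrier R" "V = {P \<in> spec R. \<not> G \<subseteq> P}" for U V E G
  proof (cases "spec R = {}")
    case True
    then show ?thesis using E by auto
  next
    case False
    then obtain Q where "primeideal Q R"
      by (auto simp: spec_def)
    then interpret R: cring R
      by (auto simp: primeideal_def)
    let ?H = "{f \<otimes>\<^bsub>R\<^esub> g | f g. f \<in> E \<and> g \<in> G}"
    have "?H \<subseteq> carrier R"
      using E(1) G(1) by auto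
    moreover have "?H \<subseteq> P \<longleftrightarrow> E \<subseteq> P \<or> G \<subseteq> P" if "P \<in> spec R" for P
    proof -
      interpret P: primeideal P R
        using that by (simp add: spec_def)
      show ?thesis
      proof
        assume H: "?H \<subseteq> P"
        show "E \<subseteq> P \<or> G \<subseteq> P"
        proof (rule ccontr)
          assume "\<not> (E \<subseteq> P \<or> G \<subseteq> P)"
          then obtain f g where fg: "f \<in> E" "f \<notin> P" "g \<in> G" "g \<notin> P"
            by blast
          then have "f \<otimes>\<^bsub>R\<^esub> g \<in> P"
            using H by blast
          then show False
            using P.I_prime[of f g] fg E(1) G(1) by blast
        qed
      next
        assume "E \<subseteq> P \<or> G \<subseteq> P"
        then have "f \<otimes>\<^bsub>R\<^esub> g \<in> P" if "f \<in> E" "g \<in> G" for f g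
          using E(1) G(1) that P.I_l_closed[of g f] P.I_r_closed[of f g] by blast
        then show "?H \<subseteq> P"
          by blast
      qed
    qed
    ultimately have "?H \<subseteq> carrier R \<and> U \<inter> V = {P \<in> spec R. \<not> ?H \<subseteq> P}"
      unfolding E(2) G(2) Collect_conj_eq[symmetric] by (simp cong: conj_cong)
    then show ?thesis
      by (rule exI)
  qed
  have **: "\<exists>E\<subseteq>carrier R. \<Union>\<U> = {P \<in> spec R. \<not> E \<subseteq> P}"
    if \<U>: "\<forall>U\<in>\<U>. \<exists>E\<subseteq>carrier R. U = {P \<in> spec R. \<not> E \<subseteq> P}" for \<U>
  proof -
    obtain F where F: "\<forall>U\<in>\<U>. F U \<subseteq> carrier R \<and> U = {P \<in> spec R. \<not> F U \<subseteq> P}"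
      using bchoice[OF \<U>] ..
    have sub: "\<Union>(F ` \<U>) \<subseteq> carrier R"
      using F by (simp add: UN_least)
    have mem: "x \<in> U \<longleftrightarrow> x \<in> {P \<in> spec R. \<not> F U \<subseteq> P}" if "U \<in> \<U>" for x U
      using F that by (metis (lifting))
    have "\<Union>\<U> = {P \<in> spec R. \<not> \<Union>(F ` \<U>) \<subseteq> P}"
      unfolding set_eq_iff Union_iff using mem by blast
    with sub show ?thesis
      by blast
  qed
  show ?thesis
    unfolding istopology_def by (intro conjI allI impI; (elim exE conjE)?; (rule * **; assumption)?)
qed

end

theory Submission
  imports Defs "HOL-Analysis.Derivative" "HOL-Library.Function_Algebras"
    "HOL-Computational_Algebra.Formal_Power_Series"
    "HOL-Computational_Algebra.Fundamental_Theorem_Algebra"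
begin

text \<open>The Lie algebra consists of the vector fields \<open>V = (v\<^sub>1 t + v\<^sub>2 t\<^sup>2 + \<dots>) d/dt\<close> modulo \<open>t\<^bsup>k+1\<^esup>\<close>. The
  weight \<open>v\<^sub>1\<close> is invariant, and a vector field of weight \<open>c \<noteq> 0\<close> is conjugate to \<open>c t d/dt\<close>, so
  it is the only invariant: \<open>\<complex>[\<gg>\<^sub>k]\<^bsup>G\<^esup> = \<complex>[v\<^sub>1]\<close>. The fibres of the quotient map are the
  hyperplanes \<open>v\<^sub>1 = c\<close>, those with \<open>c \<noteq> 0\<close> are single orbits, and \<open>dv\<^sub>1\<close> vanishes nowhere. It
  remains to know the Krull dimension of an affine space: a chain of \<open>m + 1\<close> irreducible closed sets
  yields \<open>m\<close> algebraically independent functions, whose monomials of bounded degree outgrow the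
  space of polynomials in \<open>n\<close> coordinates if \<open>m > n\<close>.\<close>

section \<open>Algebras of functions\<close>

text \<open>Jets are handled as full formal power series. A matrix entry reads only coefficients of
  index at most \<open>k\<close>, so truncation is a matter of reading entries, while composition,
  compositional inverse and the chain rule hold exactly. Conjugation becomes the intertwining
  relation \<open>W oo F = fps_deriv F * V\<close>, which contains no inverse. A nonzero field with
  \<open>v_1 = 0\<close> is not conjugate to a linear one, so orbits of linear fields say nothing
  about invariants there. The gap is closed on lines in the direction \<open>t d/dt\<close>: an
  invariant restricts to a polynomial that is already known at all parameters but one. The Lie
  algebra is given as a space of point derivations. It is bounded from above because the first row
  of a matrix generates all entries, and from below by the curves \<open>t + s V\<close>. The upper
  bound for the dimension is proved for arbitrary subsets of an affine space, since orbits need not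
  be closed.\<close>

definition fun_subalgebra :: "'p set \<Rightarrow> ('p \<Rightarrow> complex) set \<Rightarrow> bool" where
  "fun_subalgebra S F \<longleftrightarrow> F \<subseteq> extensional S \<and> (\<forall>c. (\<lambda>x\<in>S. c) \<in> F) \<and>
     (\<forall>f\<in>F. \<forall>g\<in>F. (\<lambda>x\<in>S. f x + g x) \<in> F) \<and> (\<forall>f\<in>F. \<forall>g\<in>F. (\<lambda>x\<in>S. f x * g x) \<in> F)"

lemma fun_subalgebraD:
  assumes "fun_subalgebra S F"
  shows "f \<in> F \<Longrightarrow> f \<in> extensional S" "(\<lambda>x\<in>S. c) \<in> F"
    "f \<in> F \<Longrightarrow> g \<in> F \<Longrightarrow> (\<lambda>x\<in>S. f x + g x) \<in> F"
    "f \<in> F \<Longrightarrow> g \<in> F \<Longrightarrow> (\<lambda>x\<in>S. f x * g x) \<in> F"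
  using assms by (auto simp: fun_subalgebra_def)

lemma fun_subalgebra_scale:
  assumes "fun_subalgebra S F" "f \<in> F"
  shows "(\<lambda>x\<in>S. c * f x) \<in> F"
proof -
  have "(\<lambda>x\<in>S. c * f x) = (\<lambda>x\<in>S. (\<lambda>x\<in>S. c) x * f x)"
    by auto
  then show ?thesis
    using fun_subalgebraD(2,4)[OF assms(1)] assms(2) by metis
qed

lemma fun_alg_cring:
  assumes "fun_subalgebra S F"
  shows "cring (fun_alg S F)"
proof (rule cringI)
  note closed = fun_subalgebraD[OF assms]
  have ext: "f x = undefined" if "f \<in> F" "x \<notin> S" for f x
    using closed(1)[OF that(1)] that(2) by (auto simp: extensional_def)
  show "abelian_group (fun_alg S F)"
  proof (rule abelian_groupI)
    fix f assume "f \<in> carrier (fun_alg S F)"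
    then have f: "f \<in> F"
      by (simp add: fun_alg_def)
    show "\<exists>g\<in>carrier (fun_alg S F). g \<oplus>\<^bsub>fun_alg S F\<^esub> f = \<zero>\<^bsub>fun_alg S F\<^esub>"
      using fun_subalgebra_scale[OF assms f, of "-1"]
      by (intro bexI[of _ "\<lambda>x\<in>S. -1 * f x"]) (auto simp: fun_alg_def)
  qed (auto simp: fun_alg_def closed fun_eq_iff ext)
  show "Group.comm_monoid (fun_alg S F)"
    by (rule comm_monoidI) (auto simp: fun_alg_def closed fun_eq_iff ext)
qed (auto simp: fun_alg_def fun_eq_iff algebra_simps)

lemma fun_subalgebra_coord_funs: "fun_subalgebra S (coord_funs k S)"
  unfolding fun_subalgebra_def
proof (intro conjI ballI allI)
  show "coord_funs k S \<subseteq> extensional S"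
    by (auto simp: coord_funs_def)
  show "(\<lambda>x\<in>S. c) \<in> coord_funs k S" for c
    using mat_poly_funs.const[of c k] by (auto simp: coord_funs_def)
  fix f g assume "f \<in> coord_funs k S" "g \<in> coord_funs k S"
  then obtain p q where pq: "p \<in> mat_poly_funs k" "q \<in> mat_poly_funs k"
    and f: "f = restrict p S" and g: "g = restrict q S"
    by (auto simp: coord_funs_def)
  have "(\<lambda>x\<in>S. f x + g x) = restrict (\<lambda>x. p x + q x) S"
    "(\<lambda>x\<in>S. f x * g x) = restrict (\<lambda>x. p x * q x) S"
    by (auto simp: f g)
  then show "(\<lambda>x\<in>S. f x + g x) \<in> coord_funs k S" "(\<lambda>x\<in>S. f x * g x) \<in> coord_funs k S"
    using mat_poly_funs.add[OF pq] mat_poly_funs.mult[OF pq] by (auto simp: coord_funs_def)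
qed

lemma tangent_spaceD:
  assumes "D \<in> tangent_space S F x"
  shows "D \<in> extensional F"
    "f \<in> F \<Longrightarrow> g \<in> F \<Longrightarrow> D (\<lambda>y\<in>S. f y + g y) = D f + D g"
    "f \<in> F \<Longrightarrow> D (\<lambda>y\<in>S. c * f y) = c * D f"
    "f \<in> F \<Longrightarrow> g \<in> F \<Longrightarrow> D (\<lambda>y\<in>S. f y * g y) = f x * D g + g x * D f"
  using assms by (auto simp: tangent_space_def)

lemma tangent_space_const:
  assumes "fun_subalgebra S F" "x \<in> S" "D \<in> tangent_space S F x"
  shows "D (\<lambda>y\<in>S. c) = 0"
proof -
  have one: "(\<lambda>y\<in>S. 1) \<in> F"
    by (rule fun_subalgebraD(2)[OF assms(1)])
  have "D (\<lambda>y\<in>S. (\<lambda>y\<in>S. 1) y * (\<lambda>y\<in>S. 1) y) = D (\<lambda>y\<in>S. 1) + D (\<lambda>y\<in>S. 1)"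
    using tangent_spaceD(4)[OF assms(3) one one] assms(2) by simp
  moreover have "(\<lambda>y\<in>S. (\<lambda>y\<in>S. 1) y * (\<lambda>y\<in>S. 1) y) = (\<lambda>y\<in>S. 1::complex)"
    by auto
  ultimately have 1: "D (\<lambda>y\<in>S. 1) = 0"
    by simp
  have "D (\<lambda>y\<in>S. c * (\<lambda>y\<in>S. 1) y) = c * D (\<lambda>y\<in>S. 1)"
    by (rule tangent_spaceD(3)[OF assms(3) one])
  moreover have "(\<lambda>y\<in>S. c * (\<lambda>y\<in>S. 1) y) = (\<lambda>y\<in>S. c)"
    by auto
  ultimately show ?thesis
    using 1 by simp
qed

text \<open>By linearity and the Leibniz rule two derivations need to be compared on generators
  only. The notion \<open>fun_subalgebra\<close> covers coordinate rings and invariants alike, so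
  the argument serves both the Lie algebra and the differential of the quotient map.\<close>

lemma fun_subalgebra_tangent_agree:
  assumes "fun_subalgebra S F" "x \<in> S" "D \<in> tangent_space S F x" "D' \<in> tangent_space S F x"
  shows "fun_subalgebra S {f \<in> F. D f = D' f}"
  using assms fun_subalgebraD[OF assms(1)]
  unfolding fun_subalgebra_def
  by (auto simp: tangent_space_const[OF assms(1-3)] tangent_space_const[OF assms(1,2,4)]
      tangent_spaceD(2)[OF assms(3)] tangent_spaceD(2)[OF assms(4)]
      tangent_spaceD(4)[OF assms(3)] tangent_spaceD(4)[OF assms(4)])

lemma fun_subalgebra_sum:
  assumes "fun_subalgebra S F" "finite I" "\<And>i. i \<in> I \<Longrightarrow> (\<lambda>x\<in>S. f i x) \<in> F"
  shows "(\<lambda>x\<in>S. \<Sum>i\<in>I. f i x) \<in> F"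
  using assms(2,3)
proof (induction I rule: finite_induct)
  case empty
  show ?case
    unfolding sum.empty by (rule fun_subalgebraD(2)[OF assms(1)])
next
  case (insert i I)
  have "(\<lambda>x\<in>S. \<Sum>i\<in>insert i I. f i x) = (\<lambda>x\<in>S. (\<lambda>x\<in>S. f i x) x + (\<lambda>x\<in>S. \<Sum>i\<in>I. f i x) x)"
    using insert by auto
  moreover have "\<dots> \<in> F"
    by (rule fun_subalgebraD(3)[OF assms(1)]) (use insert in auto)
  ultimately show ?case
    by (simp only:)
qed

section \<open>Jets as truncated power series\<close>

text \<open>Row \<open>i\<close> lists the coefficients of \<open>F\<^bsup>i+1\<^esup>\<close>, that is, of \<open>t\<^bsup>i+1\<^esup>\<close> after the substitution
  \<open>t = F\<close>.\<close>
definition subst_mat :: "nat \<Rightarrow> complex fps \<Rightarrow> complex mat" where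
  "subst_mat k F = Matrix.mat k k (\<lambda>(i, j). fps_nth (F ^ (i + 1)) (j + 1))"

text \<open>Row \<open>i\<close> lists the coefficients of \<open>V d/dt (t\<^bsup>i+1\<^esup>)\<close>.\<close>
definition vf_mat :: "nat \<Rightarrow> complex fps \<Rightarrow> complex mat" where
  "vf_mat k V = Matrix.mat k k (\<lambda>(i, j). of_nat (i + 1) * fps_nth (fps_X ^ i * V) (j + 1))"

lemma subst_mat_carrier [simp]: "subst_mat k F \<in> carrier_mat k k"
  by (simp add: subst_mat_def)

lemma vf_mat_carrier [simp]: "vf_mat k V \<in> carrier_mat k k"
  by (simp add: vf_mat_def)

lemma jet_mat_conv_subst_mat:
  "jet_mat k a = subst_mat k (Abs_fps (\<lambda>n. if n = 0 then 0 else a n))"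
proof (rule eq_matI)
  fix i j assume "i < dim_row (subst_mat k (Abs_fps (\<lambda>n. if n = 0 then 0 else a n)))"
    "j < dim_col (subst_mat k (Abs_fps (\<lambda>n. if n = 0 then 0 else a n)))"
  then have ij: "i < k" "j < k"
    by (auto simp: subst_mat_def)
  let ?F = "Abs_fps (\<lambda>n. if n = 0 then 0 else a n)"
  let ?P = "{s :: nat list. length s = i + 1 \<and> sum_list s = j + 1 \<and> (\<forall>l \<in> set s. 1 \<le> l)}"
  have sub: "?P \<subseteq> natpermute (j + 1) (i + 1)"
    by (auto simp: natpermute_def)
  have "fps_nth (?F ^ (i + 1)) (j + 1) =
      (\<Sum>v\<in>natpermute (j + 1) (i + 1). \<Prod>l = 0..i. fps_nth ?F (v ! l))"
    using fps_power_nth_Suc[of ?F i "j + 1"] by simp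
  also have "\<dots> = (\<Sum>v\<in>natpermute (j + 1) (i + 1). prod_list (map (fps_nth ?F) v))"
  proof (rule sum.cong[OF refl])
    fix v assume "v \<in> natpermute (j + 1) (i + 1)"
    then have "length v = Suc i"
      by (simp add: natpermute_def)
    then show "(\<Prod>l = 0..i. fps_nth ?F (v ! l)) = prod_list (map (fps_nth ?F) v)"
      by (simp add: prod.list_conv_set_nth atLeastLessThanSuc_atLeastAtMost)
  qed
  \<comment> \<open>\<open>natpermute\<close> also lists decompositions with zero parts; they
    contribute nothing because the series has no constant term.\<close>
  also have "\<dots> = (\<Sum>v\<in>?P. prod_list (map (fps_nth ?F) v))"
  proof (rule sum.mono_neutral_right[OF natpermute_finite sub], rule ballI)
    fix v assume "v \<in> natpermute (j + 1) (i + 1) - ?P"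
    then have "0 \<in> set v"
      by (auto simp: natpermute_def Suc_le_eq)
    then show "prod_list (map (fps_nth ?F) v) = 0"
      by (force simp: prod_list_zero_iff)
  qed
  also have "\<dots> = (\<Sum>v\<in>?P. prod_list (map a v))"
    by (intro sum.cong refl arg_cong[of _ _ prod_list] map_cong) auto
  finally show "jet_mat k a $$ (i, j) = subst_mat k ?F $$ (i, j)"
    using ij by (simp add: jet_mat_def subst_mat_def)
qed (auto simp: jet_mat_def subst_mat_def)

text \<open>Coefficients beyond \<open>k\<close> do not enter the matrix, so any lift of a jet to a
  power series may be used.\<close>

lemma carrier_jet_group:
  "carrier (jet_group k) = {subst_mat k F | F. fps_nth F 0 = 0 \<and> fps_nth F 1 \<noteq> 0}"
proof (intro equalityI subsetI)
  fix A assume "A \<in> carrier (jet_group k)"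
  then obtain a where "A = jet_mat k a" "a 1 \<noteq> 0"
    by (auto simp: jet_group_def)
  then show "A \<in> {subst_mat k F | F. fps_nth F 0 = 0 \<and> fps_nth F 1 \<noteq> 0}"
    using jet_mat_conv_subst_mat[of k a] by force
next
  fix A assume "A \<in> {subst_mat k F | F. fps_nth F 0 = 0 \<and> fps_nth F 1 \<noteq> 0}"
  then obtain F where F: "A = subst_mat k F" "fps_nth F 0 = 0" "fps_nth F 1 \<noteq> 0"
    by auto
  have "Abs_fps (\<lambda>n. if n = 0 then 0 else fps_nth F n) = F"
    using F(2) by (auto simp: fps_eq_iff)
  then have "A = jet_mat k (fps_nth F)"
    using jet_mat_conv_subst_mat[of k "fps_nth F"] F(1) by simp
  then show "A \<in> carrier (jet_group k)"
    using F(3) by (auto simp: jet_group_def)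
qed

text \<open>A matrix product sums over \<open>l < k\<close> only. Up to degree \<open>k\<close> this
  loses nothing: \<open>G ^ l\<close> has order at least \<open>l\<close>, and \<open>P\<close> has
  no constant term.\<close>

lemma fps_compose_nth_truncate:
  fixes P G :: "complex fps"
  assumes "fps_nth P 0 = 0" "fps_nth G 0 = 0" "n \<le> k"
  shows "fps_nth (P oo G) n = (\<Sum>l<k. fps_nth P (l + 1) * fps_nth (G ^ (l + 1)) n)"
proof -
  have "fps_nth (P oo G) n = (\<Sum>l\<in>{0..n}. fps_nth P l * fps_nth (G ^ l) n)"
    by (simp add: fps_compose_nth)
  also have "\<dots> = (\<Sum>l\<in>{0..k}. fps_nth P l * fps_nth (G ^ l) n)"
    using assms startsby_zero_power_prefix[OF assms(2)]
    by (intro sum.mono_neutral_left) auto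
  also have "\<dots> = (\<Sum>l\<in>{1..k}. fps_nth P l * fps_nth (G ^ l) n)"
    using assms(1) by (intro sum.mono_neutral_right) (auto simp: Suc_le_eq)
  also have "\<dots> = (\<Sum>l<k. fps_nth P (l + 1) * fps_nth (G ^ (l + 1)) n)"
    by (rule sum.reindex_bij_witness[of _ "\<lambda>l. l + 1" "\<lambda>l. l - 1"]) auto
  finally show ?thesis .
qed

text \<open>Row \<open>i\<close> holds the power \<open>F ^ (i + 1)\<close>; multiplying on the
  right by the matrix of \<open>G\<close> substitutes \<open>G\<close> in it, and substitution
  commutes with powers.\<close>

lemma subst_mat_mult:
  assumes "fps_nth F 0 = 0" "fps_nth G 0 = 0"
  shows "subst_mat k F * subst_mat k G = subst_mat k (F oo G)"
proof (rule eq_matI)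
  fix i j assume "i < dim_row (subst_mat k (F oo G))" "j < dim_col (subst_mat k (F oo G))"
  then have ij: "i < k" "j < k"
    by (auto simp: subst_mat_def)
  have "(subst_mat k F * subst_mat k G) $$ (i, j) =
      (\<Sum>l<k. fps_nth (F ^ (i + 1)) (l + 1) * fps_nth (G ^ (l + 1)) (j + 1))"
    using ij by (simp add: subst_mat_def scalar_prod_def atLeast0LessThan)
  also have "\<dots> = fps_nth (F ^ (i + 1) oo G) (j + 1)"
    using ij assms by (subst fps_compose_nth_truncate[of _ _ _ k]) auto
  finally show "(subst_mat k F * subst_mat k G) $$ (i, j) = subst_mat k (F oo G) $$ (i, j)"
    using ij assms(2) by (simp add: subst_mat_def fps_compose_power[OF assms(2)] del: power_Suc)
qed (auto simp: subst_mat_def)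

lemma subst_mat_X: "subst_mat k fps_X = 1\<^sub>m k"
  by (rule eq_matI) (auto simp: subst_mat_def simp del: power_Suc)

lemma subst_mat_inverse:
  assumes "fps_nth F 0 = 0" "fps_nth F 1 \<noteq> 0"
  shows "subst_mat k (fps_inv F) \<in> carrier (jet_group k)"
    "subst_mat k (fps_inv F) * subst_mat k F = 1\<^sub>m k"
    "subst_mat k F * subst_mat k (fps_inv F) = 1\<^sub>m k"
proof -
  have 0: "fps_nth (fps_inv F) 0 = 0"
    by (simp add: fps_inv_def)
  have 1: "fps_nth (fps_inv F) 1 \<noteq> 0"
    using assms(2) by (simp add: fps_inv_def)
  show "subst_mat k (fps_inv F) \<in> carrier (jet_group k)"
    unfolding carrier_jet_group using 0 1 by blast
  show "subst_mat k (fps_inv F) * subst_mat k F = 1\<^sub>m k"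
    "subst_mat k F * subst_mat k (fps_inv F) = 1\<^sub>m k"
    using assms 0 by (simp_all add: subst_mat_mult fps_inv fps_inv_right subst_mat_X)
qed

lemma group_jet_group: "group (jet_group k)"
proof (rule groupI)
  show "A \<otimes>\<^bsub>jet_group k\<^esub> B \<in> carrier (jet_group k)"
    if A: "A \<in> carrier (jet_group k)" and B: "B \<in> carrier (jet_group k)" for A B
  proof -
    obtain F where F: "A = subst_mat k F" "fps_nth F 0 = 0" "fps_nth F 1 \<noteq> 0"
      using A unfolding carrier_jet_group by blast
    obtain G where G: "B = subst_mat k G" "fps_nth G 0 = 0" "fps_nth G 1 \<noteq> 0"
      using B unfolding carrier_jet_group by blast
    note FG = F G
    have "fps_nth (F oo G) 0 = 0" "fps_nth (F oo G) 1 \<noteq> 0"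
      using FG by (auto simp: fps_compose_nth)
    moreover have "A \<otimes>\<^bsub>jet_group k\<^esub> B = subst_mat k (F oo G)"
      using FG by (simp add: jet_group_def subst_mat_mult)
    ultimately show ?thesis
      unfolding carrier_jet_group by blast
  qed
  show "\<one>\<^bsub>jet_group k\<^esub> \<in> carrier (jet_group k)"
    unfolding carrier_jet_group
    by (auto simp: jet_group_def subst_mat_X[symmetric] intro!: exI[of _ fps_X])
  show "\<exists>B\<in>carrier (jet_group k). B \<otimes>\<^bsub>jet_group k\<^esub> A = \<one>\<^bsub>jet_group k\<^esub>"
    if A: "A \<in> carrier (jet_group k)" for A
  proof -
    obtain F where F: "A = subst_mat k F" "fps_nth F 0 = 0" "fps_nth F 1 \<noteq> 0"
      using A unfolding carrier_jet_group by blast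
    show ?thesis
      using subst_mat_inverse[OF F(2,3), of k]
      by (intro bexI[of _ "subst_mat k (fps_inv F)"]) (simp_all add: F(1) jet_group_def)
  qed
qed (auto simp: jet_group_def jet_mat_conv_subst_mat assoc_mult_mat[of _ k k _ k _ k] left_mult_one_mat[of _ k k])

section \<open>The adjoint action as the transformation law of vector fields\<close>

lemma Ad_subst_mat:
  assumes "fps_nth F 0 = 0" "fps_nth F 1 \<noteq> 0"
  shows "Ad k (subst_mat k F) X = subst_mat k F * X * subst_mat k (fps_inv F)"
proof -
  interpret G: group "jet_group k"
    by (rule group_jet_group)
  have "inv\<^bsub>jet_group k\<^esub> (subst_mat k F) = subst_mat k (fps_inv F)"
    using subst_mat_inverse[OF assms, of k] assms carrier_jet_group[of k]
    by (intro G.inv_equality) (auto simp: jet_group_def)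
  then show ?thesis
    by (simp add: Ad_def)
qed

text \<open>Multiplying on the right by \<open>vf_mat k V\<close> applies \<open>V d/dt\<close> to
  each row, and the derivative of \<open>F ^ (i + 1)\<close> is
  \<open>(i + 1) F ^ i F'\<close>.\<close>

lemma subst_mat_mult_vf_mat:
  assumes "fps_nth F 0 = 0" "fps_nth V 0 = 0"
  shows "subst_mat k F * vf_mat k V =
    Matrix.mat k k (\<lambda>(i, j). of_nat (i + 1) * fps_nth (F ^ i * (fps_deriv F * V)) (j + 1))"
proof (rule eq_matI, goal_cases)
  case (1 i j)
  then have ij: "i < k" "j < k"
    by auto
  define P where "P = F ^ (i + 1)"
  have "(subst_mat k F * vf_mat k V) $$ (i, j) =
      (\<Sum>l<k. fps_nth P (l + 1) * (of_nat (l + 1) * fps_nth (fps_X ^ l * V) (j + 1)))"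
    using ij by (simp add: subst_mat_def vf_mat_def scalar_prod_def atLeast0LessThan P_def)
  also have "\<dots> = (\<Sum>l<k. fps_nth (fps_deriv P) l * (if j + 1 < l then 0 else fps_nth V (j + 1 - l)))"
    by (intro sum.cong) (auto simp: fps_X_power_mult_nth)
  \<comment> \<open>The summand \<open>l = j + 1\<close> drops out since \<open>V\<close> has no
    constant term; this keeps the range inside \<open>l < k\<close> even for
    \<open>j = k - 1\<close>.\<close>
  also have "\<dots> = (\<Sum>l\<in>{0..j}. fps_nth (fps_deriv P) l * fps_nth V (j + 1 - l))"
    using ij assms(2) by (intro sum.mono_neutral_cong_right) (auto simp: not_le less_Suc_eq)
  also have "\<dots> = (\<Sum>l\<in>{0..j + 1}. fps_nth (fps_deriv P) l * fps_nth V (j + 1 - l))"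
    using assms(2) by simp
  also have "\<dots> = fps_nth (fps_deriv P * V) (j + 1)"
    by (simp add: fps_mult_nth)
  also have "fps_deriv P * V = fps_const (of_nat (i + 1)) * (F ^ i * (fps_deriv F * V))"
    by (simp only: P_def fps_deriv_power add_diff_cancel_right' mult_ac)
  finally show ?case
    using ij by simp
qed (simp_all add: subst_mat_def vf_mat_def)

lemma vf_mat_mult_subst_mat:
  assumes "fps_nth F 0 = 0" "fps_nth W 0 = 0"
  shows "vf_mat k W * subst_mat k F =
    Matrix.mat k k (\<lambda>(i, j). of_nat (i + 1) * fps_nth (F ^ i * (W oo F)) (j + 1))"
proof (rule eq_matI, goal_cases)
  case (1 i j)
  then have ij: "i < k" "j < k"
    by auto
  define P where "P = fps_X ^ i * W"
  have "(vf_mat k W * subst_mat k F) $$ (i, j) =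
      of_nat (i + 1) * (\<Sum>l<k. fps_nth P (l + 1) * fps_nth (F ^ (l + 1)) (j + 1))"
    using ij
    by (simp add: subst_mat_def vf_mat_def scalar_prod_def atLeast0LessThan P_def sum_distrib_left mult.assoc)
  also have "\<dots> = of_nat (i + 1) * fps_nth (P oo F) (j + 1)"
    using ij assms by (subst fps_compose_nth_truncate[of P F _ k]) (auto simp: P_def)
  also have "P oo F = F ^ i * (W oo F)"
    using assms(1) by (simp add: P_def fps_compose_mult_distrib fps_compose_power[symmetric])
  finally show ?case
    using ij by simp
qed (simp_all add: subst_mat_def vf_mat_def)

text \<open>The hypothesis \<open>eq\<close> is the transformation law of a vector field under the
  change of coordinate \<open>F\<close>. By the two product formulas it makes the matrices
  \<open>A X\<close> and \<open>Y A\<close> equal row by row; the inverse enters only at the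
  end.\<close>

lemma Ad_vf_mat:
  assumes F: "fps_nth F 0 = 0" "fps_nth F 1 \<noteq> 0" and V: "fps_nth V 0 = 0" "fps_nth W 0 = 0"
    and eq: "W oo F = fps_deriv F * V"
  shows "Ad k (subst_mat k F) (vf_mat k V) = vf_mat k W"
proof -
  have *: "subst_mat k F * vf_mat k V = vf_mat k W * subst_mat k F"
    by (simp add: subst_mat_mult_vf_mat vf_mat_mult_subst_mat F V eq)
  have "Ad k (subst_mat k F) (vf_mat k V) = vf_mat k W * subst_mat k F * subst_mat k (fps_inv F)"
    using F by (simp add: Ad_subst_mat *)
  also have "\<dots> = vf_mat k W * (subst_mat k F * subst_mat k (fps_inv F))"
    by (rule assoc_mult_mat[of _ k k _ k _ k]) auto
  finally show ?thesis
    by (simp add: subst_mat_inverse[OF F] right_mult_one_mat[of _ k k])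
qed

text \<open>The transformation law forces \<open>W\<close> to be \<open>F' V\<close> composed with
  the inverse of \<open>F\<close>. Its coefficients of \<open>t\<close> give
  \<open>w_1 f_1 = f_1 v_1\<close>, the invariance of the weight.\<close>

lemma Ad_vf_mat_ex:
  assumes F: "fps_nth F 0 = 0" "fps_nth F 1 \<noteq> 0" and V: "fps_nth V 0 = 0"
  shows "\<exists>W. fps_nth W 0 = 0 \<and> fps_nth W 1 = fps_nth V 1 \<and>
    Ad k (subst_mat k F) (vf_mat k V) = vf_mat k W"
proof (intro exI conjI)
  let ?W = "(fps_deriv F * V) oo fps_inv F"
  have 0: "fps_nth (fps_inv F) 0 = 0"
    by (simp add: fps_inv_def)
  show W0: "fps_nth ?W 0 = 0"
    using V by simp
  have eq: "?W oo F = fps_deriv F * V"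
    using F 0 by (simp add: fps_compose_assoc[symmetric] fps_inv)
  have "fps_nth ?W 1 * fps_nth F 1 = fps_nth (?W oo F) 1"
    using W0 by (simp add: fps_compose_nth)
  also have "\<dots> = fps_nth F 1 * fps_nth V 1"
    using V by (simp add: eq fps_mult_nth)
  finally show "fps_nth ?W 1 = fps_nth V 1"
    using F by simp
  show "Ad k (subst_mat k F) (vf_mat k V) = vf_mat k ?W"
    by (rule Ad_vf_mat[OF F V W0 eq])
qed

text \<open>A linearizing coordinate \<open>H\<close> of \<open>W\<close> solves \<open>c H = H' W\<close>. With \<open>W = c t (1 - t R)\<close> and
  \<open>H = t K\<close> this becomes \<open>K' (1 - t R) = K R\<close>, whose solution is an exponential.\<close>
lemma vf_linearize_ex:
  fixes W :: "complex fps"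
  assumes "fps_nth W 0 = 0" "fps_nth W 1 \<noteq> 0"
  shows "\<exists>H. fps_nth H 0 = 0 \<and> fps_nth H 1 = 1 \<and> fps_const (fps_nth W 1) * H = fps_deriv H * W"
proof -
  let ?c = "fps_nth W 1"
  define R where "R = Abs_fps (\<lambda>n. - fps_nth W (n + 2) / ?c)"
  define U where "U = 1 - fps_X * R"
  have U0: "fps_nth U 0 = 1"
    by (simp add: U_def)
  have W: "W = fps_const ?c * fps_X * U"
    unfolding fps_eq_iff
  proof
    fix n :: nat
    consider "n = 0" | "n = 1" | m where "n = m + 2"
      by (metis One_nat_def add_2_eq_Suc' not0_implies_Suc)
    then show "fps_nth W n = fps_nth (fps_const ?c * fps_X * U) n"
      using assms by cases (auto simp: U_def R_def mult.assoc)
  qed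
  \<comment> \<open>Separation of variables: \<open>K' / K = R / U\<close>, where \<open>U\<close>
    is invertible since its constant term is 1. The integral has no constant term, so it may be
    substituted into \<open>fps_exp 1\<close>, and \<open>K\<close> starts with 1.\<close>
  define K where "K = fps_exp 1 oo fps_integral0 (R * inverse U)"
  have "fps_deriv K = K * (R * inverse U)"
    by (simp add: K_def fps_compose_deriv fps_exp_deriv fps_deriv_fps_integral)
  then have "fps_deriv K * U = K * R * (inverse U * U)"
    by (simp only: mult.assoc)
  then have K': "fps_deriv K * U = K * R"
    using U0 by (simp add: inverse_mult_eq_1)
  have K0: "fps_nth K 0 = 1"
    by (simp add: K_def)
  show ?thesis
  proof (intro exI conjI)
    let ?H = "fps_X * K"
    show "fps_nth ?H 0 = 0" "fps_nth ?H 1 = 1"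
      using K0 by simp_all
    have "fps_deriv ?H * W = fps_const ?c * fps_X * (K * U + fps_X * (fps_deriv K * U))"
      by (subst (1) W) (simp add: algebra_simps)
    also have "K * U + fps_X * (fps_deriv K * U) = K"
      by (simp only: K') (simp add: U_def algebra_simps)
    finally show "fps_const ?c * ?H = fps_deriv ?H * W"
      by (simp add: mult.assoc)
  qed
qed

text \<open>The linearizing equation is the transformation law with target \<open>c t d/dt\<close>,
  because substituting \<open>H\<close> into \<open>c t\<close> gives \<open>c H\<close>.\<close>

lemma Ad_linearize_ex:
  assumes "fps_nth W 0 = 0" "fps_nth W 1 \<noteq> 0"
  shows "\<exists>H. fps_nth H 0 = 0 \<and> fps_nth H 1 \<noteq> 0 \<and>
    Ad k (subst_mat k H) (vf_mat k W) = vf_mat k (fps_const (fps_nth W 1) * fps_X)"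
proof -
  obtain H where H: "fps_nth H 0 = 0" "fps_nth H 1 = 1"
    and eq: "fps_const (fps_nth W 1) * H = fps_deriv H * W"
    using vf_linearize_ex[OF assms] by blast
  have "(fps_const (fps_nth W 1) * fps_X) oo H = fps_deriv H * W"
    using H(1) by (simp add: fps_compose_mult_distrib flip: eq)
  then have "Ad k (subst_mat k H) (vf_mat k W) = vf_mat k (fps_const (fps_nth W 1) * fps_X)"
    using H assms by (intro Ad_vf_mat) auto
  then show ?thesis
    using H by (intro exI[of _ H]) simp
qed

section \<open>The Lie algebra of the group of jets\<close>

lemma entry_in_coord_funs: "i < k \<Longrightarrow> j < k \<Longrightarrow> (\<lambda>X\<in>S. X $$ (i, j)) \<in> coord_funs k S"
  using mat_poly_funs.entry by (auto simp: coord_funs_def)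

lemma mat_poly_funs_poly_curve:
  assumes "p \<in> mat_poly_funs k"
    and "\<And>i j. i < k \<Longrightarrow> j < k \<Longrightarrow> \<exists>q. \<forall>s. M s $$ (i, j) = poly q s"
  shows "\<exists>q. \<forall>s. p (M s) = poly q s"
  using assms(1)
proof induction
  case (const c)
  show ?case
    by (intro exI[of _ "[:c:]"]) simp
next
  case (entry i j)
  then show ?case
    by (rule assms(2))
next
  case (add f g)
  then obtain q r where "\<forall>s. f (M s) = poly q s" "\<forall>s. g (M s) = poly r s"
    by blast
  then show ?case
    by (intro exI[of _ "q + r"]) simp
next
  case (mult f g)
  then obtain q r where "\<forall>s. f (M s) = poly q s" "\<forall>s. g (M s) = poly r s"
    by blast
  then show ?case
    by (intro exI[of _ "q * r"]) simp
qed

section \<open>Point derivations along polynomial curves\<close>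

text \<open>The velocity of a curve as a point derivation. It depends only on the germ at 0, so the
  curve may leave \<open>S\<close> for other parameters, where extensional functions have no
  meaningful value.\<close>

definition curve_derivation ::
  "nat \<Rightarrow> complex mat set \<Rightarrow> (complex \<Rightarrow> complex mat) \<Rightarrow> (complex mat \<Rightarrow> complex) \<Rightarrow> complex" where
  "curve_derivation k S M = (\<lambda>f\<in>coord_funs k S. deriv (\<lambda>s. f (M s)) 0)"

lemma curve_derivation_eq:
  assumes "f \<in> coord_funs k S" "\<forall>\<^sub>F s in nhds 0. f (M s) = poly q s"
  shows "curve_derivation k S M f = coeff q 1"
proof -
  have "((\<lambda>s. f (M s)) has_field_derivative poly (pderiv q) 0) (at 0)"
    using assms(2) by (subst DERIV_cong_ev[OF refl _ refl]) (auto intro: poly_DERIV)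
  then show ?thesis
    using assms(1) by (simp add: curve_derivation_def DERIV_imp_deriv poly_0_coeff_0 coeff_pderiv)
qed

lemma curve_derivation_in_tangent_space:
  assumes S: "\<forall>\<^sub>F s in nhds 0. M s \<in> S" and x: "M 0 = x"
    and M: "\<And>i j. i < k \<Longrightarrow> j < k \<Longrightarrow> \<exists>q. \<forall>s. M s $$ (i, j) = poly q s"
  shows "curve_derivation k S M \<in> tangent_space S (coord_funs k S) x"
proof -
  let ?F = "coord_funs k S"
  let ?D = "curve_derivation k S M"
  note closed = fun_subalgebraD[OF fun_subalgebra_coord_funs[of S k]]
  have ex: "\<exists>q. (\<forall>\<^sub>F s in nhds 0. f (M s) = poly q s)" if f: "f \<in> ?F" for f
  proof -
    obtain p where p: "p \<in> mat_poly_funs k" "f = restrict p S"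
      using f by (auto simp: coord_funs_def)
    obtain q where "\<forall>s. p (M s) = poly q s"
      using mat_poly_funs_poly_curve[OF p(1) M] by blast
    then have "\<forall>\<^sub>F s in nhds 0. f (M s) = poly q s"
      using S by (auto elim!: eventually_mono simp: p(2))
    then show ?thesis ..
  qed
  have val: "f x = coeff q 0" if "\<forall>\<^sub>F s in nhds 0. f (M s) = poly q s" for f q
    using eventually_nhds_x_imp_x[OF that] by (simp add: x poly_0_coeff_0)
  show ?thesis
    unfolding tangent_space_def
  proof (intro CollectI conjI ballI allI)
    show "?D \<in> extensional ?F"
      by (simp add: curve_derivation_def)
    fix f assume f: "f \<in> ?F"
    obtain q where q: "\<forall>\<^sub>F s in nhds 0. f (M s) = poly q s"
      using ex[OF f] ..
    show "?D (\<lambda>y\<in>S. c * f y) = c * ?D f" for c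
    proof -
      have "\<forall>\<^sub>F s in nhds 0. (\<lambda>y\<in>S. c * f y) (M s) = poly (smult c q) s"
        using q S by eventually_elim simp
      from curve_derivation_eq[OF fun_subalgebra_scale[OF fun_subalgebra_coord_funs f] this]
      show ?thesis
        unfolding curve_derivation_eq[OF f q] coeff_smult .
    qed
    fix g assume g: "g \<in> ?F"
    obtain r where r: "\<forall>\<^sub>F s in nhds 0. g (M s) = poly r s"
      using ex[OF g] ..
    show "?D (\<lambda>y\<in>S. f y + g y) = ?D f + ?D g"
    proof -
      have "\<forall>\<^sub>F s in nhds 0. (\<lambda>y\<in>S. f y + g y) (M s) = poly (q + r) s"
        using q r S by eventually_elim simp
      from curve_derivation_eq[OF closed(3)[OF f g] this] show ?thesis
        unfolding curve_derivation_eq[OF f q] curve_derivation_eq[OF g r] coeff_add .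
    qed
    show "?D (\<lambda>y\<in>S. f y * g y) = f x * ?D g + g x * ?D f"
    proof -
      have "\<forall>\<^sub>F s in nhds 0. (\<lambda>y\<in>S. f y * g y) (M s) = poly (q * r) s"
        using q r S by eventually_elim simp
      from curve_derivation_eq[OF closed(4)[OF f g] this]
      have "?D (\<lambda>y\<in>S. f y * g y) = coeff (q * r) 1" .
      \<comment> \<open>The linear coefficient of a product is the Leibniz rule, the constant
        coefficients being the values at \<open>x\<close>.\<close>
      also have "\<dots> = coeff q 0 * coeff r 1 + coeff r 0 * coeff q 1"
        by (simp add: coeff_mult)
      finally show ?thesis
        using curve_derivation_eq[OF f q] curve_derivation_eq[OF g r] val[OF q] val[OF r] by simp
    qed
  qed
qed

text \<open>This is \<open>F ^ (i + 2) = F * F ^ (i + 1)\<close> read in coefficients. Both ends of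
  the convolution vanish because neither factor has a constant term, which leaves exactly indices of
  columns.\<close>

lemma subst_mat_entry_Suc:
  assumes "X \<in> carrier (jet_group k)" "i + 1 < k" "j < k"
  shows "X $$ (i + 1, j) = (\<Sum>m<j. X $$ (0, m) * X $$ (i, j - 1 - m))"
proof -
  obtain F where F: "X = subst_mat k F" "fps_nth F 0 = 0"
    using assms(1) unfolding carrier_jet_group by blast
  have "X $$ (i + 1, j) = (\<Sum>l\<in>{0..j + 1}. fps_nth F l * fps_nth (F ^ (i + 1)) (j + 1 - l))"
    using assms(2,3) by (simp add: F subst_mat_def fps_mult_nth)
  also have "\<dots> = (\<Sum>l\<in>{1..j}. fps_nth F l * fps_nth (F ^ (i + 1)) (j + 1 - l))"
    using F(2) by (intro sum.mono_neutral_right) (auto simp: not_le Suc_le_eq less_Suc_eq)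
  also have "\<dots> = (\<Sum>m<j. fps_nth F (m + 1) * fps_nth (F ^ (i + 1)) (j - 1 - m + 1))"
    by (rule sum.reindex_bij_witness[of _ "\<lambda>l. l + 1" "\<lambda>l. l - 1"])
      (auto simp: Suc_diff_le)
  also have "\<dots> = (\<Sum>m<j. X $$ (0, m) * X $$ (i, j - 1 - m))"
    using assms(2,3) by (intro sum.cong) (auto simp: F subst_mat_def)
  finally show ?thesis .
qed

text \<open>The recursion for the rows expresses every entry by the first row. A derivation at the
  identity is therefore determined by \<open>k\<close> numbers, the upper bound for the Lie
  algebra.\<close>

lemma first_row_generates:
  fixes k defines "S \<equiv> carrier (jet_group k)"
  assumes F: "fun_subalgebra S F" and e: "\<And>j. j < k \<Longrightarrow> (\<lambda>X\<in>S. X $$ (0, j)) \<in> F"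
    and "i < k" "j < k"
  shows "(\<lambda>X\<in>S. X $$ (i, j)) \<in> F"
  using assms(4,5)
proof (induction i arbitrary: j)
  case 0
  then show ?case
    by (intro e)
next
  case (Suc i)
  have "(\<lambda>X\<in>S. X $$ (0, m) * X $$ (i, j - 1 - m)) \<in> F" if "m < j" for m
  proof -
    have "(\<lambda>X\<in>S. X $$ (0, m) * X $$ (i, j - 1 - m)) =
        (\<lambda>X\<in>S. (\<lambda>X\<in>S. X $$ (0, m)) X * (\<lambda>X\<in>S. X $$ (i, j - 1 - m)) X)"
      by auto
    moreover have "\<dots> \<in> F"
      by (intro fun_subalgebraD(4)[OF F] e Suc.IH) (use Suc.prems that in simp_all)
    ultimately show ?thesis
      by (simp only:)
  qed
  then have "(\<lambda>X\<in>S. \<Sum>m<j. X $$ (0, m) * X $$ (i, j - 1 - m)) \<in> F"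
    by (intro fun_subalgebra_sum[OF F]) auto
  moreover have "(\<lambda>X\<in>S. X $$ (Suc i, j)) = (\<lambda>X\<in>S. \<Sum>m<j. X $$ (0, m) * X $$ (i, j - 1 - m))"
    using subst_mat_entry_Suc[of _ k i j] Suc.prems by (intro restrict_ext) (simp add: S_def)
  ultimately show ?case
    by (simp only:)
qed

text \<open>The first-order expansion of \<open>(t + s V) ^ n\<close> in \<open>s\<close>. For
  \<open>n = 0\<close> the truncated exponent \<open>n - 1\<close> is harmless because of the factor
  \<open>of_nat n\<close>.\<close>

lemma fps_power_line_nth:
  fixes V :: "complex fps"
  shows "\<exists>q. (\<forall>s. fps_nth ((fps_X + fps_const s * V) ^ n) m = poly q s) \<and>
    coeff q 0 = fps_nth (fps_X ^ n) m \<and> coeff q 1 = fps_nth (of_nat n * fps_X ^ (n - 1) * V) m"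
proof (induction n arbitrary: m)
  case 0
  show ?case
    by (intro exI[of _ "[:fps_nth 1 m:]"]) simp
next
  case (Suc n)
  then obtain q where q: "\<And>m s. fps_nth ((fps_X + fps_const s * V) ^ n) m = poly (q m) s"
    and q0: "\<And>m. coeff (q m) 0 = fps_nth (fps_X ^ n) m"
    and q1: "\<And>m. coeff (q m) 1 = fps_nth (of_nat n * fps_X ^ (n - 1) * V) m"
    by metis
  let ?q = "\<Sum>i=0..m. [:fps_nth fps_X i, fps_nth V i:] * q (m - i)"
  have "fps_nth ((fps_X + fps_const s * V) ^ Suc n) m = poly ?q s" for s
    by (simp add: fps_mult_nth[of _ "_ ^ n"] poly_sum q distrib_right mult.assoc sum.distrib sum_distrib_left)
  moreover have "coeff ?q 0 = fps_nth (fps_X ^ Suc n) m"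
    by (simp add: coeff_sum fps_mult_nth[of _ "_ ^ n"] q0 del: fps_X_nth fps_X_power_nth)
  moreover have "coeff ?q 1 = fps_nth (of_nat (Suc n) * fps_X ^ n * V) m"
  proof -
    have "coeff ?q 1 = (\<Sum>i=0..m. fps_nth fps_X i * coeff (q (m - i)) 1 + fps_nth V i * coeff (q (m - i)) 0)"
      by (simp add: coeff_sum)
    also have "\<dots> = fps_nth (fps_X * (of_nat n * fps_X ^ (n - 1) * V) + V * fps_X ^ n) m"
      unfolding q0 q1 by (simp only: sum.distrib fps_mult_nth[symmetric] fps_add_nth)
    also have "fps_X * (of_nat n * fps_X ^ (n - 1) * V) + V * fps_X ^ n = of_nat (Suc n) * fps_X ^ n * V"
      by (cases n) (simp_all add: algebra_simps)
    finally show ?thesis .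
  qed
  ultimately show ?case
    by (intro exI[of _ ?q]) simp
qed

lemma curve_derivation_subst_mat:
  fixes k V
  defines "S \<equiv> carrier (jet_group k)"
    and "D \<equiv> curve_derivation k (carrier (jet_group k)) (\<lambda>s. subst_mat k (fps_X + fps_const s * V))"
  assumes V: "fps_nth V 0 = 0"
  shows "D \<in> tangent_space S (coord_funs k S) (1\<^sub>m k)"
    "i < k \<Longrightarrow> j < k \<Longrightarrow> D (\<lambda>X\<in>S. X $$ (i, j)) = vf_mat k V $$ (i, j)"
proof -
  let ?M = "\<lambda>s. subst_mat k (fps_X + fps_const s * V)"
  have entry: "\<exists>q. (\<forall>s. ?M s $$ (i, j) = poly q s) \<and> coeff q 1 = vf_mat k V $$ (i, j)"
    if "i < k" "j < k" for i j
    using fps_power_line_nth[of V "i + 1" "j + 1"] that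
    by (auto simp: subst_mat_def vf_mat_def mult.assoc fps_of_nat simp flip: fps_of_nat simp del: power_Suc)
  \<comment> \<open>The curve leaves the group where its linear coefficient \<open>1 + s v_1\<close>
    vanishes, hence the restriction to \<open>s\<close> near 0.\<close>
  have "((\<lambda>s. 1 + s * fps_nth V 1) \<longlongrightarrow> 1 + 0 * fps_nth V 1) (nhds 0)"
    by (intro tendsto_intros filterlim_ident)
  then have "\<forall>\<^sub>F s in nhds 0. 1 + s * fps_nth V 1 \<noteq> 0"
    by (rule tendsto_imp_eventually_ne) simp
  then have ev: "\<forall>\<^sub>F s in nhds 0. ?M s \<in> S"
  proof eventually_elim
    case (elim s)
    then show ?case
      unfolding S_def carrier_jet_group using V
      by (intro CollectI exI[of _ "fps_X + fps_const s * V"]) auto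
  qed
  show "D \<in> tangent_space S (coord_funs k S) (1\<^sub>m k)"
    unfolding D_def S_def[symmetric]
    by (rule curve_derivation_in_tangent_space[OF ev]) (use entry in \<open>simp add: subst_mat_X, blast\<close>)
  assume ij: "i < k" "j < k"
  then obtain q where q: "\<forall>s. ?M s $$ (i, j) = poly q s" "coeff q 1 = vf_mat k V $$ (i, j)"
    using entry by blast
  have "D (\<lambda>X\<in>S. X $$ (i, j)) = coeff q 1"
    unfolding D_def S_def[symmetric]
  proof (rule curve_derivation_eq[OF entry_in_coord_funs[OF ij]])
    show "\<forall>\<^sub>F s in nhds 0. (\<lambda>X\<in>S. X $$ (i, j)) (?M s) = poly q s"
      using ev by eventually_elim (simp add: q(1))
  qed
  then show "D (\<lambda>X\<in>S. X $$ (i, j)) = vf_mat k V $$ (i, j)"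
    using q(2) by simp
qed

lemma jet_lie_eq: "jet_lie k = {vf_mat k V | V. fps_nth V 0 = 0}"
proof -
  let ?S = "carrier (jet_group k)"
  let ?F = "coord_funs k ?S"
  let ?curve = "\<lambda>V. curve_derivation k ?S (\<lambda>s. subst_mat k (fps_X + fps_const s * V))"
  have one: "1\<^sub>m k \<in> ?S"
    using group.is_monoid[OF group_jet_group[of k]] monoid.one_closed[of "jet_group k"]
    by (simp add: jet_group_def)
  have mat: "Matrix.mat k k (\<lambda>(i, j). D (\<lambda>X\<in>?S. X $$ (i, j))) = vf_mat k V"
    if "\<And>i j. i < k \<Longrightarrow> j < k \<Longrightarrow> D (\<lambda>X\<in>?S. X $$ (i, j)) = vf_mat k V $$ (i, j)" for D V
    using that by (intro eq_matI) (auto simp: vf_mat_def)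
  show ?thesis
  proof (intro equalityI subsetI)
    fix A assume "A \<in> jet_lie k"
    then obtain D where D: "D \<in> tangent_space ?S ?F (1\<^sub>m k)"
      and A: "A = Matrix.mat k k (\<lambda>(i, j). D (\<lambda>X\<in>?S. X $$ (i, j)))"
      by (auto simp: jet_lie_def)
    \<comment> \<open>The candidate is read off the first row of \<open>D\<close>, whose column
      \<open>n - 1\<close> belongs to \<open>t ^ n\<close>. The derivation along
      \<open>t + s V\<close> then agrees with \<open>D\<close> on the first row, hence on all
      entries.\<close>
    define V where
      "V = Abs_fps (\<lambda>n. if n = 0 then 0 else D (\<lambda>X\<in>?S. X $$ (0, n - 1)))"
    have V: "fps_nth V 0 = 0"
      by (simp add: V_def)
    note D' = curve_derivation_subst_mat[OF V, where k = k]
    let ?E = "{f \<in> ?F. D f = ?curve V f}"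
    have E: "fun_subalgebra ?S ?E"
      by (rule fun_subalgebra_tangent_agree[OF fun_subalgebra_coord_funs one D D'(1)])
    have row: "(\<lambda>X\<in>?S. X $$ (0, j)) \<in> ?E" if "j < k" for j
    proof -
      have "vf_mat k V $$ (0, j) = D (\<lambda>X\<in>?S. X $$ (0, j))"
        using that by (simp add: vf_mat_def V_def)
      then show ?thesis
        using that D'(2)[where i = 0 and j = j] entry_in_coord_funs[of 0 k j ?S] by simp
    qed
    have "D (\<lambda>X\<in>?S. X $$ (i, j)) = vf_mat k V $$ (i, j)" if "i < k" "j < k" for i j
      using first_row_generates[OF E row that] D'(2)[OF that] by simp
    then have "A = vf_mat k V"
      unfolding A by (rule mat)
    then show "A \<in> {vf_mat k V | V. fps_nth V 0 = 0}"
      using V by blast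
  next
    fix A assume "A \<in> {vf_mat k V | V. fps_nth V 0 = 0}"
    then obtain V where V: "A = vf_mat k V" "fps_nth V 0 = 0"
      by blast
    have "vf_mat k V = Matrix.mat k k (\<lambda>(i, j). ?curve V (\<lambda>X\<in>?S. X $$ (i, j)))"
      by (rule mat[symmetric]) (rule curve_derivation_subst_mat(2)[OF V(2)])
    then show "A \<in> jet_lie k"
      unfolding jet_lie_def V(1) using curve_derivation_subst_mat(1)[OF V(2)] by blast
  qed
qed

section \<open>The invariants\<close>

lemma vf_mat_in_jet_lie: "fps_nth V 0 = 0 \<Longrightarrow> vf_mat k V \<in> jet_lie k"
  by (auto simp: jet_lie_eq)

lemma vf_mat_first_row: "j < k \<Longrightarrow> vf_mat k V $$ (0, j) = fps_nth V (j + 1)"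
  by (simp add: vf_mat_def)

text \<open>Each row is a shifted and scaled copy of the first, so the first row is a linear
  coordinate system. The entry with \<open>i = j + 1\<close> is a multiple of the constant
  coefficient of the field and vanishes as well.\<close>

lemma jet_lie_entry:
  assumes "X \<in> jet_lie k" "i < k" "j < k"
  shows "X $$ (i, j) = (if i \<le> j then of_nat (i + 1) * X $$ (0, j - i) else 0)"
proof -
  obtain V where "X = vf_mat k V" "fps_nth V 0 = 0"
    using assms(1) unfolding jet_lie_eq by blast
  then show ?thesis
    using assms(2,3)
    by (cases "i = j + 1") (auto simp: vf_mat_def fps_X_power_mult_nth Suc_diff_le)
qed

lemma vf_mat_line:
  assumes "i < k" "j < k"
  shows "vf_mat k (V + fps_const s * W) $$ (i, j) = poly [:vf_mat k V $$ (i, j), vf_mat k W $$ (i, j):] s"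
proof -
  have "fps_X ^ i * (V + fps_const s * W) = fps_X ^ i * V + fps_const s * (fps_X ^ i * W)"
    by (simp add: algebra_simps)
  then show ?thesis
    using assms by (simp add: vf_mat_def) (simp add: algebra_simps)
qed

lemma mat_poly_funs_line:
  assumes "p \<in> mat_poly_funs k"
  shows "\<exists>q. \<forall>s. p (vf_mat k (V + fps_const s * W)) = poly q s"
  by (rule mat_poly_funs_poly_curve[OF assms]) (use vf_mat_line in blast)

lemma mat_poly_funs_poly:
  assumes "p \<in> mat_poly_funs k"
  shows "(\<lambda>X. poly q (p X)) \<in> mat_poly_funs k"
proof (induction q)
  case 0
  show ?case
    using mat_poly_funs.const[of 0] by simp
next
  case (pCons a q)
  then show ?case
    using mat_poly_funs.add[OF mat_poly_funs.const mat_poly_funs.mult[OF assms pCons.IH]] by simp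
qed

lemma poly_eqI_off_zero:
  fixes p q :: "complex poly"
  assumes "\<And>s. s \<noteq> 0 \<Longrightarrow> poly p s = poly q s"
  shows "p = q"
proof (rule ccontr)
  assume "p \<noteq> q"
  then have "finite {s. poly (p - q) s = 0}"
    by (intro poly_roots_finite) simp
  moreover have "UNIV - {0} \<subseteq> {s. poly (p - q) s = 0}"
    using assms by auto
  ultimately have "finite (UNIV - {0 :: complex})"
    by (rule finite_subset[rotated])
  then show False
    by (simp add: infinite_UNIV_char_0)
qed

text \<open>The entry \<open>(0, 0)\<close> is the weight \<open>v_1\<close>. Parametrizing by
  \<open>complex poly\<close> reduces the algebra of invariants to polynomials in one
  variable.\<close>

definition weight_fun :: "nat \<Rightarrow> complex poly \<Rightarrow> complex mat \<Rightarrow> complex" where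
  "weight_fun k q = (\<lambda>X\<in>jet_lie k. poly q (X $$ (0, 0)))"

lemma weight_fun_apply: "X \<in> jet_lie k \<Longrightarrow> weight_fun k q X = poly q (X $$ (0, 0))"
  by (simp add: weight_fun_def)

text \<open>Restricting an invariant to the multiples of \<open>t d/dt\<close> yields the polynomial
  \<open>q\<close>, and conjugacy carries the formula to all fields of nonzero weight.\<close>

lemma inv_funs_eq:
  assumes "k \<ge> 1"
  shows "inv_funs k = range (weight_fun k)"
proof (intro equalityI subsetI)
  fix f assume "f \<in> inv_funs k"
  then obtain p where p: "p \<in> mat_poly_funs k" and f: "f = restrict p (jet_lie k)"
    and inv: "\<And>A X. A \<in> carrier (jet_group k) \<Longrightarrow> X \<in> jet_lie k \<Longrightarrow> f (Ad k A X) = f X"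
    by (auto simp: inv_funs_def coord_funs_def)
  obtain q where q: "\<And>s. p (vf_mat k (0 + fps_const s * fps_X)) = poly q s"
    using mat_poly_funs_line[OF p, of 0 fps_X] by blast
  have nz: "p (vf_mat k V) = poly q (fps_nth V 1)" if V: "fps_nth V 0 = 0" "fps_nth V 1 \<noteq> 0" for V
  proof -
    obtain H where H: "fps_nth H 0 = 0" "fps_nth H 1 \<noteq> 0"
      and eq: "Ad k (subst_mat k H) (vf_mat k V) = vf_mat k (fps_const (fps_nth V 1) * fps_X)"
      using Ad_linearize_ex[OF V] by blast
    have "subst_mat k H \<in> carrier (jet_group k)"
      unfolding carrier_jet_group using H by blast
    from inv[OF this vf_mat_in_jet_lie[OF V(1)]] show ?thesis
      using q[of "fps_nth V 1"] V(1) by (simp add: eq f vf_mat_in_jet_lie)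
  qed
  have "p (vf_mat k V) = poly q (fps_nth V 1)" if V: "fps_nth V 0 = 0" for V
  proof (cases "fps_nth V 1 = 0")
    case True
    \<comment> \<open>On this line the weight is \<open>s\<close>, so \<open>r\<close> and
      \<open>q\<close> agree for \<open>s \<noteq> 0\<close> and hence at \<open>s = 0\<close>,
      where the line passes through \<open>V\<close>.\<close>
    obtain r where r: "\<And>s. p (vf_mat k (V + fps_const s * fps_X)) = poly r s"
      using mat_poly_funs_line[OF p] by blast
    have "r = q"
    proof (rule poly_eqI_off_zero)
      fix s :: complex assume "s \<noteq> 0"
      then show "poly r s = poly q s"
        using nz[of "V + fps_const s * fps_X"] V True by (simp add: r)
    qed
    then show ?thesis
      using r[of 0] True by simp
  qed (use nz V in auto)
  then have "f = weight_fun k q"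
    using assms by (auto simp: f weight_fun_def fun_eq_iff jet_lie_eq vf_mat_first_row)
  then show "f \<in> range (weight_fun k)"
    by blast
next
  fix f assume "f \<in> range (weight_fun k)"
  then obtain q where f: "f = weight_fun k q"
    by blast
  have "f \<in> coord_funs k (jet_lie k)"
    unfolding f weight_fun_def coord_funs_def
    by (rule imageI, rule mat_poly_funs_poly, rule mat_poly_funs.entry) (use assms in auto)
  moreover have "f (Ad k A X) = f X" if A: "A \<in> carrier (jet_group k)" and X: "X \<in> jet_lie k" for A X
  proof -
    obtain F where F: "fps_nth F 0 = 0" "fps_nth F 1 \<noteq> 0" "A = subst_mat k F"
      using A unfolding carrier_jet_group by blast
    obtain V where V: "fps_nth V 0 = 0" "X = vf_mat k V"
      using X unfolding jet_lie_eq by blast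
    obtain W where W: "fps_nth W 0 = 0" "fps_nth W 1 = fps_nth V 1" "Ad k A X = vf_mat k W"
      using Ad_vf_mat_ex[OF F(1,2) V(1), of k] unfolding F(3) V(2) by blast
    show ?thesis
      unfolding W(3) using assms V(1) W(1,2) by (simp add: V(2) f weight_fun_apply vf_mat_in_jet_lie vf_mat_first_row)
  qed
  ultimately show "f \<in> inv_funs k"
    by (simp add: inv_funs_def)
qed

lemma weight_fun_const: "weight_fun k [:c:] = (\<lambda>x\<in>jet_lie k. c)"
  and weight_fun_add: "weight_fun k (p + q) = (\<lambda>x\<in>jet_lie k. weight_fun k p x + weight_fun k q x)"
  and weight_fun_mult: "weight_fun k (p * q) = (\<lambda>x\<in>jet_lie k. weight_fun k p x * weight_fun k q x)"
  by (auto simp: weight_fun_def)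

lemma fun_subalgebra_range_weight_fun: "fun_subalgebra (jet_lie k) (range (weight_fun k))"
  unfolding fun_subalgebra_def
proof (intro conjI ballI allI)
  show "range (weight_fun k) \<subseteq> extensional (jet_lie k)"
    by (auto simp: weight_fun_def)
  show "(\<lambda>x\<in>jet_lie k. c) \<in> range (weight_fun k)" for c
    unfolding weight_fun_const[symmetric] by (rule rangeI)
  fix f g assume "f \<in> range (weight_fun k)" "g \<in> range (weight_fun k)"
  then obtain p q where pq: "f = weight_fun k p" "g = weight_fun k q"
    by blast
  show "(\<lambda>x\<in>jet_lie k. f x + g x) \<in> range (weight_fun k)"
    "(\<lambda>x\<in>jet_lie k. f x * g x) \<in> range (weight_fun k)"
    unfolding pq weight_fun_add[symmetric] weight_fun_mult[symmetric] by (rule rangeI)+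
qed

lemma weight_attained:
  assumes "k \<ge> 1"
  shows "\<exists>X\<in>jet_lie k. X $$ (0, 0) = c"
  using assms vf_mat_first_row[of 0 k "fps_const c * fps_X"]
  by (intro bexI[of _ "vf_mat k (fps_const c * fps_X)"]) (simp_all add: vf_mat_in_jet_lie)

lemma weight_fun_inject:
  assumes "k \<ge> 1"
  shows "weight_fun k p = weight_fun k q \<longleftrightarrow> p = q"
proof
  assume eq: "weight_fun k p = weight_fun k q"
  show "p = q"
  proof (rule poly_eqI_off_zero)
    fix s
    obtain X where "X \<in> jet_lie k" "X $$ (0, 0) = s"
      using weight_attained[OF assms] by blast
    then show "poly p s = poly q s"
      using fun_cong[OF eq, of X] by (simp add: weight_fun_apply)
  qed
qed simp

text \<open>The maximal ideal of the point \<open>v_1 = c\<close> of the affine line.\<close>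

definition weight_ideal :: "nat \<Rightarrow> complex \<Rightarrow> (complex mat \<Rightarrow> complex) set" where
  "weight_ideal k c = {weight_fun k q | q. poly q c = 0}"

lemma weight_fun_in_weight_ideal:
  "k \<ge> 1 \<Longrightarrow> weight_fun k q \<in> weight_ideal k c \<longleftrightarrow> poly q c = 0"
  by (auto simp: weight_ideal_def weight_fun_inject)

lemma weight_ideal_inject:
  assumes "k \<ge> 1"
  shows "weight_ideal k c = weight_ideal k d \<longleftrightarrow> c = d"
  using weight_fun_in_weight_ideal[OF assms, of "[:-c, 1:]" c]
    weight_fun_in_weight_ideal[OF assms, of "[:-c, 1:]" d] by auto

section \<open>Fibres of the quotient map and orbits\<close>

lemma quot_map_eq:
  assumes "k \<ge> 1" "X \<in> jet_lie k"
  shows "quot_map k X = weight_ideal k (X $$ (0, 0))"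
proof -
  have "range (weight_fun k) \<subseteq> coord_funs k (jet_lie k)"
    using inv_funs_eq[OF assms(1)] by (auto simp: inv_funs_def)
  then show ?thesis
    unfolding quot_map_def inv_funs_eq[OF assms(1)] weight_ideal_def
    using assms(2) by (auto simp: weight_fun_apply)
qed

lemma fibre_weight_ideal:
  assumes "k \<ge> 1"
  shows "fibre k (weight_ideal k c) = {X \<in> jet_lie k. X $$ (0, 0) = c}"
  using assms by (auto simp: fibre_def quot_map_eq weight_ideal_inject)

lemma zero_in_jet_lie: "0\<^sub>m k k \<in> jet_lie k"
proof -
  have "vf_mat k 0 = 0\<^sub>m k k"
    by (auto simp: vf_mat_def)
  then show ?thesis
    using vf_mat_in_jet_lie[of 0 k] by simp
qed

lemma null_cone_eq:
  assumes "k \<ge> 1"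
  shows "null_cone k = {X \<in> jet_lie k. X $$ (0, 0) = 0}"
  using assms by (simp add: null_cone_def quot_map_eq zero_in_jet_lie fibre_weight_ideal)

lemma jet_orbit_subset:
  assumes "k \<ge> 1" "X \<in> jet_lie k"
  shows "jet_orbit k X \<subseteq> {Y \<in> jet_lie k. Y $$ (0, 0) = X $$ (0, 0)}"
proof
  fix Y assume "Y \<in> jet_orbit k X"
  then obtain F where F: "fps_nth F 0 = 0" "fps_nth F 1 \<noteq> 0" "Y = Ad k (subst_mat k F) X"
    unfolding orbit_def carrier_jet_group by blast
  obtain V where V: "fps_nth V 0 = 0" "X = vf_mat k V"
    using assms(2) unfolding jet_lie_eq by blast
  obtain W where W: "fps_nth W 0 = 0" "fps_nth W 1 = fps_nth V 1" "Y = vf_mat k W"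
    using Ad_vf_mat_ex[OF F(1,2) V(1), of k] unfolding F(3) V(2) by blast
  show "Y \<in> {Y \<in> jet_lie k. Y $$ (0, 0) = X $$ (0, 0)}"
    using assms(1) W V by (auto simp: vf_mat_in_jet_lie vf_mat_first_row)
qed

text \<open>If \<open>H\<close> linearizes a field of weight 1, the inverse of \<open>H\<close>
  moves \<open>t d/dt\<close> to that field. This orbit fills a whole fibre and so attains the
  maximal dimension.\<close>

lemma jet_orbit_linear:
  assumes "k \<ge> 1"
  shows "jet_orbit k (vf_mat k fps_X) = {X \<in> jet_lie k. X $$ (0, 0) = 1}"
proof
  have "vf_mat k fps_X \<in> jet_lie k" "vf_mat k fps_X $$ (0, 0) = 1"
    using assms by (auto simp: vf_mat_in_jet_lie vf_mat_first_row)
  then show "jet_orbit k (vf_mat k fps_X) \<subseteq> {X \<in> jet_lie k. X $$ (0, 0) = 1}"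
    using jet_orbit_subset[OF assms] by force
  show "{X \<in> jet_lie k. X $$ (0, 0) = 1} \<subseteq> jet_orbit k (vf_mat k fps_X)"
  proof
    fix X assume "X \<in> {X \<in> jet_lie k. X $$ (0, 0) = 1}"
    then obtain V where V: "X = vf_mat k V" "fps_nth V 0 = 0" "fps_nth V 1 = 1"
      using assms by (auto simp: jet_lie_eq vf_mat_first_row)
    obtain H where H: "fps_nth H 0 = 0" "fps_nth H 1 \<noteq> 0"
      and eq: "Ad k (subst_mat k H) X = vf_mat k fps_X"
      using Ad_linearize_ex[OF V(2), of k] V by auto
    let ?A = "subst_mat k H" and ?B = "subst_mat k (fps_inv H)"
    note inv = subst_mat_inverse[OF H, of k]
    have "fps_nth (fps_inv H) 0 = 0" "fps_nth (fps_inv H) 1 \<noteq> 0"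
      using H by (simp_all add: fps_inv_def)
    then have "Ad k ?B (vf_mat k fps_X) = ?B * vf_mat k fps_X * subst_mat k (fps_inv (fps_inv H))"
      by (rule Ad_subst_mat)
    also have "fps_inv (fps_inv H) = H"
      using H by (simp add: fps_inv_idempotent)
    also have "?B * vf_mat k fps_X * ?A = ?B * (?A * X * ?B) * ?A"
      using eq by (simp add: Ad_subst_mat[OF H])
    also have "\<dots> = (?B * ?A) * X * (?B * ?A)"
      by (simp add: V(1) assoc_mult_mat[of _ k k _ k _ k] mult_carrier_mat[of _ k k])
    also have "\<dots> = X"
      by (simp add: inv V(1) left_mult_one_mat[of _ k k] right_mult_one_mat[of _ k k])
    finally show "X \<in> jet_orbit k (vf_mat k fps_X)"
      using inv(1) unfolding orbit_def by force
  qed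
qed

section \<open>The differential of the quotient map\<close>

lemma tangent_space_restrict:
  assumes "F' \<subseteq> F" "fun_subalgebra S F'" "D \<in> tangent_space S F x"
  shows "restrict D F' \<in> tangent_space S F' x"
  unfolding tangent_space_def
  using assms(1) fun_subalgebraD(3,4)[OF assms(2)] fun_subalgebra_scale[OF assms(2)]
    tangent_spaceD(2-4)[OF assms(3)]
  by (auto simp: subset_iff)

text \<open>A point derivation of the invariants is determined by its value on \<open>v_1\<close>,
  and any value is realized by a motion in the direction \<open>t d/dt\<close>, at every
  point.\<close>

lemma submersive_points_eq:
  assumes "k \<ge> 1"
  shows "submersive_points k = jet_lie k"
proof -
  let ?S = "jet_lie k"
  let ?R = "range (weight_fun k)"
  have R: "?R \<subseteq> coord_funs k ?S"
    using inv_funs_eq[OF assms(1)] by (auto simp: inv_funs_def)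
  have "\<exists>D\<in>tangent_space ?S (coord_funs k ?S) x. D' = restrict D ?R"
    if x: "x \<in> ?S" and D': "D' \<in> tangent_space ?S ?R x" for x D'
  proof -
    obtain V where V: "fps_nth V 0 = 0" "x = vf_mat k V"
      using x unfolding jet_lie_eq by blast
    define c where "c = D' (weight_fun k [:0, 1:])"
    \<comment> \<open>Along this curve \<open>v_1\<close> moves with speed \<open>c\<close>, the
      value that \<open>D'\<close> prescribes on the generator.\<close>
    let ?M = "\<lambda>s. vf_mat k (V + fps_const s * (fps_const c * fps_X))"
    have M: "?M s \<in> ?S" for s
      using V(1) by (intro vf_mat_in_jet_lie) simp
    let ?D = "curve_derivation k ?S ?M"
    have D: "?D \<in> tangent_space ?S (coord_funs k ?S) x"
    proof (rule curve_derivation_in_tangent_space)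
      show "\<forall>\<^sub>F s in nhds 0. ?M s \<in> ?S"
        using M by (intro always_eventually allI)
      show "?M 0 = x"
        by (simp add: V(2))
      show "\<exists>q. \<forall>s. ?M s $$ (i, j) = poly q s" if "i < k" "j < k" for i j
        using vf_mat_line[OF that] by blast
    qed
    have restr: "restrict ?D ?R \<in> tangent_space ?S ?R x"
      by (rule tangent_space_restrict[OF R fun_subalgebra_range_weight_fun D])
    let ?E = "{f \<in> ?R. D' f = restrict ?D ?R f}"
    have E: "fun_subalgebra ?S ?E"
      by (rule fun_subalgebra_tangent_agree[OF fun_subalgebra_range_weight_fun x D' restr])
    have gen: "weight_fun k [:0, 1:] \<in> ?E"
    proof -
      have "?D (weight_fun k [:0, 1:]) = coeff [:fps_nth V 1, c:] 1"
        using R assms M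
        by (intro curve_derivation_eq) (auto simp: weight_fun_apply vf_mat_first_row intro!: always_eventually)
      then show ?thesis
        by (simp add: c_def)
    qed
    have "weight_fun k q \<in> ?E" for q
    proof (induction q)
      case 0
      have "weight_fun k 0 = (\<lambda>x\<in>?S. 0)"
        using weight_fun_const[of k 0] by simp
      moreover have "\<dots> \<in> ?E"
        by (rule fun_subalgebraD(2)[OF E])
      ultimately show ?case
        by (simp only:)
    next
      case (pCons a q)
      have "weight_fun k (pCons a q) = weight_fun k ([:a:] + [:0, 1:] * q)"
        by simp
      also have "\<dots> \<in> ?E"
        unfolding weight_fun_add weight_fun_mult weight_fun_const
        by (intro fun_subalgebraD[OF E] gen pCons.IH)
      finally show ?case .
    qed
    then have "D' f = restrict ?D ?R f" if "f \<in> ?R" for f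
      using that by auto
    moreover have "D' \<in> extensional ?R"
      by (rule tangent_spaceD(1)[OF D'])
    ultimately have "D' = restrict ?D ?R"
      by (intro extensionalityI[of _ ?R]) auto
    then show ?thesis
      using D by blast
  qed
  then show ?thesis
    unfolding submersive_points_def quot_diff_def inv_funs_eq[OF assms]
    using tangent_space_restrict[OF R fun_subalgebra_range_weight_fun] by blast
qed

section \<open>Krull dimension of affine space\<close>

lemma krull_dim_le:
  assumes "\<And>n Z. (\<forall>i\<le>n. closedin X (Z i) \<and> irreducible_in X (Z i)) \<Longrightarrow> (\<forall>i<n. Z i \<subset> Z (Suc i)) \<Longrightarrow> n \<le> N"
  shows "krull_dim X \<le> ereal (real N)"
  unfolding krull_dim_def by (rule Sup_least) (use assms in auto)

lemma krull_dim_ge: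
  assumes "\<And>i. i \<le> n \<Longrightarrow> closedin X (Z i)" "\<And>i. i \<le> n \<Longrightarrow> irreducible_in X (Z i)"
    and "\<And>i. i < n \<Longrightarrow> Z i \<subset> Z (Suc i)"
  shows "ereal (real n) \<le> krull_dim X"
  unfolding krull_dim_def by (rule Sup_upper) (use assms in blast)

lemma irreducible_in_subtopology:
  assumes "irreducible_in X Z" "Z \<subseteq> T"
  shows "irreducible_in (subtopology X T) Z"
  unfolding irreducible_in_def
proof (intro conjI allI impI)
  show "Z \<subseteq> topspace (subtopology X T)" "Z \<noteq> {}"
    using assms by (auto simp: irreducible_in_def)
  fix A B assume AB: "closedin (subtopology X T) A \<and> closedin (subtopology X T) B \<and> Z \<subseteq> A \<union> B"
  then obtain A' B' where "closedin X A'" "A = A' \<inter> T" "closedin X B'" "B = B' \<inter> T"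
    by (auto simp: closedin_subtopology)
  moreover from this have "Z \<subseteq> A' \<union> B'"
    using AB by blast
  ultimately show "Z \<subseteq> A \<or> Z \<subseteq> B"
    using assms unfolding irreducible_in_def by (metis Int_greatest)
qed

lemma closedin_zariski:
  "closedin (zariski k S) C \<longleftrightarrow> (\<exists>P\<subseteq>mat_poly_funs k. C = {x \<in> S. \<forall>p\<in>P. p x = 0})"
proof -
  have openin: "openin (zariski k S) U \<longleftrightarrow> (\<exists>F\<subseteq>coord_funs k S. U = {x \<in> S. \<exists>f\<in>F. f x \<noteq> 0})" for U
    unfolding zariski_def by (simp add: topology_inverse'[OF istopology_zariski])
  have top: "topspace (zariski k S) = S"
  proof
    show "topspace (zariski k S) \<subseteq> S"
      unfolding topspace_def openin by blast
    have "openin (zariski k S) S"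
      unfolding openin
      using fun_subalgebraD(2)[OF fun_subalgebra_coord_funs[of S k], of 1]
      by (intro exI[of _ "{\<lambda>x\<in>S. 1}"]) auto
    then show "S \<subseteq> topspace (zariski k S)"
      by (rule openin_subset)
  qed
  show ?thesis
  proof
    assume "closedin (zariski k S) C"
    then obtain F where F: "C \<subseteq> S" "F \<subseteq> coord_funs k S" "S - C = {x \<in> S. \<exists>f\<in>F. f x \<noteq> 0}"
      unfolding closedin_def top openin by blast
    let ?P = "{p \<in> mat_poly_funs k. restrict p S \<in> F}"
    have "C = {x \<in> S. \<forall>f\<in>F. f x = 0}"
      using F(1,3) by blast
    also have "\<dots> = {x \<in> S. \<forall>p\<in>?P. p x = 0}"
      using F(2) by (fastforce simp: coord_funs_def)
    finally show "\<exists>P\<subseteq>mat_poly_funs k. C = {x \<in> S. \<forall>p\<in>P. p x = 0}"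
      by (intro exI[of _ ?P]) auto
  next
    assume "\<exists>P\<subseteq>mat_poly_funs k. C = {x \<in> S. \<forall>p\<in>P. p x = 0}"
    then obtain P where P: "P \<subseteq> mat_poly_funs k" "C = {x \<in> S. \<forall>p\<in>P. p x = 0}"
      by blast
    have "S - C = {x \<in> S. \<exists>f\<in>(\<lambda>p. restrict p S) ` P. f x \<noteq> 0}"
      using P(2) by auto
    moreover have "(\<lambda>p. restrict p S) ` P \<subseteq> coord_funs k S"
      using P(1) by (auto simp: coord_funs_def)
    ultimately show "closedin (zariski k S) C"
      unfolding closedin_def top openin using P(2) by blast
  qed
qed

lemma topspace_zariski [simp]: "topspace (zariski k S) = S"
proof -
  have "closedin (zariski k S) S"
    unfolding closedin_zariski by (intro exI[of _ "{}"]) auto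
  moreover have "topspace (zariski k S) \<subseteq> S"
    using closedin_topspace[of "zariski k S"] unfolding closedin_zariski by blast
  ultimately show ?thesis
    using closedin_subset by blast
qed

section \<open>Independent monomials from chains of irreducible sets\<close>

fun monomial :: "('a \<Rightarrow> complex) list \<Rightarrow> nat list \<Rightarrow> 'a \<Rightarrow> complex" where
  "monomial (g # gs) (j # js) x = g x ^ j * monomial gs js x"
| "monomial _ _ x = 1"

text \<open>Each exponent is bounded separately instead of the total degree, so that the number of
  monomials is simply \<open>(d + 1) ^ n\<close>.\<close>

definition exps :: "nat \<Rightarrow> nat \<Rightarrow> nat list set" where
  "exps d n = {js. set js \<subseteq> {..d} \<and> length js = n}"

lemma exps_0: "exps d 0 = {[]}"
  by (auto simp: exps_def)

lemma exps_Suc: "exps d (Suc n) = (\<lambda>(j, js). j # js) ` ({..d} \<times> exps d n)"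
  by (auto simp: exps_def length_Suc_conv image_def)

lemma finite_exps [simp]: "finite (exps d n)"
  unfolding exps_def by (rule finite_lists_length_eq) simp

lemma card_exps: "card (exps d n) = (d + 1) ^ n"
  unfolding exps_def by (subst card_lists_length_eq) auto

lemma sum_exps_Suc: "(\<Sum>js\<in>exps d (Suc n). f js) = (\<Sum>j\<le>d. \<Sum>js\<in>exps d n. f (j # js))"
proof -
  have "(\<Sum>js\<in>exps d (Suc n). f js) = (\<Sum>(j, js)\<in>{..d} \<times> exps d n. f (j # js))"
    unfolding exps_Suc by (subst sum.reindex) (auto simp: inj_on_def case_prod_beta)
  then show ?thesis
    by (simp add: sum.cartesian_product)
qed

text \<open>Linear independence of the restrictions to \<open>Z\<close>, as an indexed family, so
  that two members with equal restrictions are dependent. Required for the monomials of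
  \<open>exps d n\<close> for all \<open>d\<close>, it is algebraic independence on
  \<open>Z\<close>.\<close>

definition independent_on :: "'a set \<Rightarrow> 'i set \<Rightarrow> ('i \<Rightarrow> 'a \<Rightarrow> complex) \<Rightarrow> bool" where
  "independent_on Z I h \<longleftrightarrow> (\<forall>c. (\<forall>x\<in>Z. (\<Sum>i\<in>I. c i * h i x) = 0) \<longrightarrow> (\<forall>i\<in>I. c i = 0))"

lemma mat_poly_funs_sum:
  assumes "finite I" "\<And>i. i \<in> I \<Longrightarrow> f i \<in> mat_poly_funs k"
  shows "(\<lambda>x. \<Sum>i\<in>I. f i x) \<in> mat_poly_funs k"
  using assms by (induction I rule: finite_induct) (auto intro: mat_poly_funs.intros)

lemma mat_poly_funs_power: "f \<in> mat_poly_funs k \<Longrightarrow> (\<lambda>x. f x ^ n) \<in> mat_poly_funs k"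
  by (induction n) (auto intro: mat_poly_funs.intros)

lemma mat_poly_funs_monomial:
  "set gs \<subseteq> mat_poly_funs k \<Longrightarrow> monomial gs js \<in> mat_poly_funs k"
proof (induction gs arbitrary: js)
  case Nil
  have "monomial [] js = (\<lambda>x. 1)"
    by (simp add: fun_eq_iff)
  then show ?case
    by (simp add: mat_poly_funs.const)
next
  case (Cons g gs)
  have "monomial (g # gs) js = (case js of [] \<Rightarrow> \<lambda>x. 1 | j # js' \<Rightarrow> \<lambda>x. g x ^ j * monomial gs js' x)"
    by (auto simp: fun_eq_iff split: list.split)
  then show ?case
    using Cons by (auto split: list.split intro!: mat_poly_funs.const mat_poly_funs.mult mat_poly_funs_power)
qed

text \<open>A relation \<open>\<Sum>\<^sub>j u\<^sub>j f\<^sup>j = 0\<close> on \<open>Z\<close> reduces to \<open>u\<^sub>0 = 0\<close> on the smaller set \<open>Z'\<close> where \<open>f\<close>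
  vanishes; then \<open>f\<close> cancels because \<open>Z\<close> is irreducible.\<close>
lemma independent_on_Cons:
  assumes f: "f \<in> mat_poly_funs k" "\<forall>x\<in>Z'. f x = 0" and sub: "Z' \<subseteq> Z"
    and cancel: "\<And>g. g \<in> mat_poly_funs k \<Longrightarrow> \<forall>x\<in>Z. f x * g x = 0 \<Longrightarrow> \<forall>x\<in>Z. g x = 0"
    and gs: "set gs \<subseteq> mat_poly_funs k" and ind: "independent_on Z' (exps d n) (monomial gs)"
  shows "independent_on Z (exps d (Suc n)) (monomial (f # gs))"
proof -
  \<comment> \<open>The bound \<open>e\<close> on the power of \<open>f\<close> is separated from
    \<open>d\<close>: cancelling \<open>f\<close> shortens the relation by one power, while the
    other exponents stay bounded by \<open>d\<close>.\<close>
  have *: "\<forall>j\<le>e. \<forall>js\<in>exps d n. c j js = 0"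
    if "\<forall>x\<in>Z. (\<Sum>j\<le>e. f x ^ j * (\<Sum>js\<in>exps d n. c j js * monomial gs js x)) = 0"
    for e and c :: "nat \<Rightarrow> nat list \<Rightarrow> complex"
    using that
  proof (induction e arbitrary: c)
    case 0
    then have "\<forall>x\<in>Z'. (\<Sum>js\<in>exps d n. c 0 js * monomial gs js x) = 0"
      using sub by auto
    then show ?case
      using ind[unfolded independent_on_def] by auto
  next
    case (Suc e)
    let ?u = "\<lambda>j x. \<Sum>js\<in>exps d n. c j js * monomial gs js x"
    have split: "(\<Sum>j\<le>Suc e. f x ^ j * ?u j x) = ?u 0 x + f x * (\<Sum>j\<le>e. f x ^ j * ?u (Suc j) x)" for x
      by (subst sum.atMost_Suc_shift) (simp add: sum_distrib_left mult.assoc)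
    have "\<forall>x\<in>Z'. ?u 0 x = 0"
    proof
      fix x assume x: "x \<in> Z'"
      have "(\<Sum>j\<le>Suc e. f x ^ j * ?u j x) = 0"
        using Suc.prems x sub by blast
      then show "?u 0 x = 0"
        unfolding split using f(2) x by simp
    qed
    then have c0: "\<forall>js\<in>exps d n. c 0 js = 0"
      using ind[unfolded independent_on_def] by blast
    then have prod0: "\<forall>x\<in>Z. f x * (\<Sum>j\<le>e. f x ^ j * ?u (Suc j) x) = 0"
      using Suc.prems split by (metis (no_types, lifting) add.left_neutral mult_zero_left sum.neutral)
    have "(\<lambda>x. \<Sum>j\<le>e. f x ^ j * ?u (Suc j) x) \<in> mat_poly_funs k"
    proof (rule mat_poly_funs_sum)
      fix j
      have "(\<lambda>x. c (Suc j) js * monomial gs js x) \<in> mat_poly_funs k" for js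
        by (rule mat_poly_funs.mult[OF mat_poly_funs.const mat_poly_funs_monomial[OF gs]])
      then have "?u (Suc j) \<in> mat_poly_funs k"
        by (intro mat_poly_funs_sum finite_exps)
      then show "(\<lambda>x. f x ^ j * ?u (Suc j) x) \<in> mat_poly_funs k"
        by (rule mat_poly_funs.mult[OF mat_poly_funs_power[OF f(1)]])
    qed simp
    from cancel[OF this prod0] have "\<forall>x\<in>Z. (\<Sum>j\<le>e. f x ^ j * ?u (Suc j) x) = 0" .
    then have "\<forall>j\<le>e. \<forall>js\<in>exps d n. c (Suc j) js = 0"
      by (rule Suc.IH)
    then show ?case
      using c0 by (metis Suc_le_mono not0_implies_Suc)
  qed
  show ?thesis
    unfolding independent_on_def
  proof (intro allI impI)
    fix c :: "nat list \<Rightarrow> complex"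
    assume "\<forall>x\<in>Z. (\<Sum>js\<in>exps d (Suc n). c js * monomial (f # gs) js x) = 0"
    then have "\<forall>x\<in>Z. (\<Sum>j\<le>d. f x ^ j * (\<Sum>js\<in>exps d n. c (j # js) * monomial gs js x)) = 0"
      by (simp add: sum_exps_Suc sum_distrib_left mult.left_commute)
    from *[OF this] show "\<forall>js\<in>exps d (Suc n). c js = 0"
      by (auto simp: exps_Suc)
  qed
qed

text \<open>Every strict inclusion contributes one function, an equation \<open>f\<close> of the
  smaller set that does not vanish identically on the larger one.\<close>

lemma chain_independent:
  assumes "\<forall>i\<le>n. closedin (subtopology (zariski k S) T) (Z i) \<and>
      irreducible_in (subtopology (zariski k S) T) (Z i)"
    and "\<forall>i<n. Z i \<subset> Z (Suc i)"
  shows "\<exists>gs. length gs = n \<and> set gs \<subseteq> mat_poly_funs k \<and>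
    (\<forall>d. independent_on (Z n) (exps d n) (monomial gs))"
  using assms
proof (induction n)
  case 0
  then obtain x where "x \<in> Z 0"
    by (auto simp: irreducible_in_def)
  then show ?case
    by (auto simp: exps_0 independent_on_def)
next
  case (Suc n)
  let ?X = "subtopology (zariski k S) T"
  obtain gs where gs: "length gs = n" "set gs \<subseteq> mat_poly_funs k"
    and ind: "\<And>d. independent_on (Z n) (exps d n) (monomial gs)"
    using Suc.IH Suc.prems by auto
  have irr: "irreducible_in ?X (Z (Suc n))" and sub: "Z n \<subset> Z (Suc n)"
    using Suc.prems by auto
  have ZT: "Z (Suc n) \<subseteq> S \<inter> T"
    using irr by (simp add: irreducible_in_def)
  have "closedin ?X (Z n)"
    using Suc.prems by auto
  then obtain C where "closedin (zariski k S) C" "Z n = C \<inter> T"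
    by (auto simp: closedin_subtopology)
  then obtain P where P: "P \<subseteq> mat_poly_funs k" "Z n = {x \<in> S. \<forall>p\<in>P. p x = 0} \<inter> T"
    unfolding closedin_zariski by blast
  obtain y where y: "y \<in> Z (Suc n)" "y \<notin> Z n"
    using sub by blast
  then obtain f where f: "f \<in> P" "f y \<noteq> 0"
    using P(2) ZT by blast
  have fk: "f \<in> mat_poly_funs k"
    using f P by blast
  have cl: "closedin ?X ({x \<in> S. p x = 0} \<inter> T)" if "p \<in> mat_poly_funs k" for p
    unfolding closedin_subtopology closedin_zariski
    by (rule exI[of _ "{x \<in> S. p x = 0}"], intro conjI exI[of _ "{p}"]) (use that in auto)
  \<comment> \<open>The zero sets of \<open>f\<close> and \<open>g\<close> cover an irreducible set
    that does not lie in the first, so \<open>g\<close> vanishes on it.\<close>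
  have cancel: "\<forall>x\<in>Z (Suc n). g x = 0"
    if g: "g \<in> mat_poly_funs k" "\<forall>x\<in>Z (Suc n). f x * g x = 0" for g
  proof -
    have "Z (Suc n) \<subseteq> ({x \<in> S. f x = 0} \<inter> T) \<union> ({x \<in> S. g x = 0} \<inter> T)"
      using g(2) ZT by auto
    then have "Z (Suc n) \<subseteq> {x \<in> S. f x = 0} \<inter> T \<or> Z (Suc n) \<subseteq> {x \<in> S. g x = 0} \<inter> T"
      using irr cl[OF fk] cl[OF g(1)] unfolding irreducible_in_def by blast
    then show ?thesis
      using y(1) f(2) by blast
  qed
  have "independent_on (Z (Suc n)) (exps d (Suc n)) (monomial (f # gs))" for d
    using P f sub by (intro independent_on_Cons[OF fk _ _ cancel gs(2) ind]) auto
  then show ?case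
    using gs fk by (intro exI[of _ "f # gs"]) auto
qed

section \<open>Spans of bounded monomials and the dimension count\<close>

interpretation fun_space: vector_space "\<lambda>(c :: complex) (f :: 'a \<Rightarrow> complex) x. c * f x"
  by unfold_locales (auto simp: fun_eq_iff algebra_simps)

text \<open>The filtration, by the largest exponent, of the algebra generated by \<open>hs\<close>.
  Levels add under products, and level \<open>d\<close> has dimension at most
  \<open>(d + 1) ^ length hs\<close>.\<close>

abbreviation monomial_span :: "('a \<Rightarrow> complex) list \<Rightarrow> nat \<Rightarrow> ('a \<Rightarrow> complex) set" where
  "monomial_span hs d \<equiv> fun_space.span (monomial hs ` exps d (length hs))"

lemma monomial_span_mono: "d \<le> e \<Longrightarrow> monomial_span hs d \<subseteq> monomial_span hs e"
  by (intro fun_space.span_mono image_mono) (auto simp: exps_def)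

lemma monomial_span_const: "(\<lambda>x. c) \<in> monomial_span hs d"
proof -
  have "monomial hs (replicate (length hs) 0) = (\<lambda>x. 1)"
    by (induction hs) (auto simp: fun_eq_iff)
  then have "(\<lambda>x. 1) \<in> monomial hs ` exps d (length hs)"
    by (intro image_eqI[of _ _ "replicate (length hs) 0"]) (auto simp: exps_def)
  from fun_space.span_scale[OF fun_space.span_base[OF this], of c] show ?thesis
    by simp
qed

lemma monomial_span_nth:
  assumes "i < length hs"
  shows "hs ! i \<in> monomial_span hs 1"
proof -
  have "\<exists>js\<in>exps 1 (length hs). monomial hs js = hs ! i"
    using assms
  proof (induction hs arbitrary: i)
    case (Cons h hs)
    have zero: "monomial hs (replicate (length hs) 0) = (\<lambda>x. 1)"
      by (induction hs) (auto simp: fun_eq_iff)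
    show ?case
    proof (cases i)
      case 0
      then show ?thesis
        using zero by (intro bexI[of _ "1 # replicate (length hs) 0"]) (auto simp: exps_def fun_eq_iff)
    next
      case (Suc i')
      then obtain js where "js \<in> exps 1 (length hs)" "monomial hs js = hs ! i'"
        using Cons by auto
      then show ?thesis
        using Suc by (intro bexI[of _ "0 # js"]) (auto simp: exps_def fun_eq_iff)
    qed
  qed simp
  then show ?thesis
    by (metis fun_space.span_base imageI)
qed

lemma monomial_mult:
  "length js = length hs \<Longrightarrow> length js' = length hs \<Longrightarrow>
    monomial hs js x * monomial hs js' x = monomial hs (map2 (+) js js') x"
proof (induction hs arbitrary: js js')
  case (Cons h hs)
  then obtain j l j' l' where "js = j # l" "js' = j' # l'" "length l = length hs" "length l' = length hs"
    by (auto simp: length_Suc_conv)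
  then show ?case
    using Cons.IH[of l l', symmetric] by (simp add: power_add)
qed simp

lemma monomial_span_mult:
  assumes "f \<in> monomial_span hs d" "g \<in> monomial_span hs e"
  shows "(\<lambda>x. f x * g x) \<in> monomial_span hs (d + e)"
proof -
  let ?V = "monomial_span hs (d + e)"
  have base: "(\<lambda>x. u x * v x) \<in> ?V"
    if uv: "u \<in> monomial hs ` exps d (length hs)" "v \<in> monomial hs ` exps e (length hs)" for u v
  proof -
    obtain js js' where js: "u = monomial hs js" "js \<in> exps d (length hs)"
      "v = monomial hs js'" "js' \<in> exps e (length hs)"
      using uv by blast
    have "map2 (+) js js' \<in> exps (d + e) (length hs)"
      using js(2,4) by (fastforce simp: exps_def dest: set_zip_leftD set_zip_rightD intro: add_mono)
    moreover have "(\<lambda>x. u x * v x) = monomial hs (map2 (+) js js')"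
      using js by (auto simp: fun_eq_iff monomial_mult exps_def)
    ultimately show ?thesis
      by (simp add: fun_space.span_base)
  qed
  have lin: "(\<lambda>x. u x * (c * v x + w x)) \<in> ?V"
    if "(\<lambda>x. u x * v x) \<in> ?V" "(\<lambda>x. u x * w x) \<in> ?V" for u v w c
  proof -
    have "(\<lambda>x. u x * (c * v x + w x)) = (\<lambda>x. c * (u x * v x)) + (\<lambda>x. u x * w x)"
      by (auto simp: fun_eq_iff algebra_simps)
    then show ?thesis
      using fun_space.span_add[OF fun_space.span_scale[OF that(1), of c] that(2)] by simp
  qed
  have right: "(\<lambda>x. u x * g x) \<in> ?V" if u: "u \<in> monomial hs ` exps d (length hs)" for u
    using assms(2)
  proof (induction rule: fun_space.span_induct_alt)
    case base
    show ?case
      using monomial_span_const[of 0 hs "d + e"] by simp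
  next
    case (step c v w)
    show ?case
      using lin[OF base[OF u step(1)] step(2), of c] by simp
  qed
  show ?thesis
    using assms(1)
  proof (induction rule: fun_space.span_induct_alt)
    case base
    show ?case
      using monomial_span_const[of 0 hs "d + e"] by simp
  next
    case (step c v w)
    show ?case
      using lin[of g v w c] right[OF step(1)] step(2) by (simp add: mult.commute)
  qed
qed

lemma monomial_span_power:
  assumes "f \<in> monomial_span hs d"
  shows "(\<lambda>x. f x ^ j) \<in> monomial_span hs (d * j)"
proof (induction j)
  case 0
  show ?case
    using monomial_span_const[of 1] by simp
next
  case (Suc j)
  then show ?case
    using monomial_span_mult[OF assms Suc] by simp
qed

text \<open>There are \<open>length us\<close> factors, each a function of level \<open>e\<close>
  raised to a power at most \<open>d\<close>.\<close>

lemma monomial_span_monomial: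
  assumes "set us \<subseteq> monomial_span hs e" "js \<in> exps d (length us)"
  shows "monomial us js \<in> monomial_span hs (e * d * length us)"
  using assms
proof (induction us arbitrary: js)
  case Nil
  have "monomial [] js = (\<lambda>x. 1)"
    by (auto simp: fun_eq_iff)
  then show ?case
    using monomial_span_const[of 1 hs] by simp
next
  case (Cons u us)
  then obtain j l where js: "js = j # l" "j \<le> d" "l \<in> exps d (length us)"
    by (auto simp: exps_Suc)
  have "(\<lambda>x. u x ^ j) \<in> monomial_span hs (e * d)"
    using monomial_span_power[of u hs e j] monomial_span_mono[of "e * j" "e * d" hs] js(2) Cons.prems
    by auto
  then have "(\<lambda>x. u x ^ j * monomial us l x) \<in> monomial_span hs (e * d + e * d * length us)"
    using Cons js(3) by (intro monomial_span_mult) auto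
  moreover have "monomial (u # us) js = (\<lambda>x. u x ^ j * monomial us l x)"
    by (simp add: js(1) fun_eq_iff)
  ultimately show ?case
    by simp
qed

lemma sum_fun_eval: "(\<Sum>i\<in>I. f i) x = (\<Sum>i\<in>I. f i x)"
  for f :: "'i \<Rightarrow> 'a \<Rightarrow> complex"
  by (induction I rule: infinite_finite_induct) auto

text \<open>The \<open>h i\<close> agree with elements \<open>u i\<close> of the span only on
  \<open>Z\<close>. A relation among the \<open>u i\<close> restricts to one among the
  \<open>h i\<close> on \<open>Z\<close>, so the \<open>u i\<close> are independent as well.\<close>

lemma card_le_of_independent_on_span:
  assumes "finite B" "finite I" "\<And>i. i \<in> I \<Longrightarrow> \<exists>u\<in>fun_space.span B. \<forall>x\<in>Z. h i x = u x"
    and ind: "independent_on Z I h"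
  shows "card I \<le> card B"
proof -
  obtain u where u: "\<And>i. i \<in> I \<Longrightarrow> u i \<in> fun_space.span B" "\<And>i x. i \<in> I \<Longrightarrow> x \<in> Z \<Longrightarrow> h i x = u i x"
    using bchoice[of I "\<lambda>i u. u \<in> fun_space.span B \<and> (\<forall>x\<in>Z. h i x = u x)"] assms(3) by metis
  have zero: "c i = 0" if "\<And>x. (\<Sum>i\<in>I. c i * u i x) = 0" "i \<in> I" for c i
  proof -
    have "\<forall>x\<in>Z. (\<Sum>i\<in>I. c i * h i x) = 0"
      using that(1) by (simp add: u(2) cong: sum.cong)
    then show ?thesis
      using ind that(2) unfolding independent_on_def by blast
  qed
  have inj: "inj_on u I"
  proof (rule inj_onI, rule ccontr)
    fix i j assume ij: "i \<in> I" "j \<in> I" "u i = u j" "i \<noteq> j"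
    let ?c = "\<lambda>l. if l = i then 1 else if l = j then -1 else 0 :: complex"
    have "(\<Sum>l\<in>I. ?c l * u l x) = (\<Sum>l\<in>{i, j}. ?c l * u l x)" for x
      using ij assms(2) by (intro sum.mono_neutral_right) auto
    then have "(\<Sum>l\<in>I. ?c l * u l x) = 0" for x
      using ij by simp
    then have "?c i = 0"
      using ij(1) by (rule zero)
    then show False
      by simp
  qed
  have "fun_space.independent (u ` I)"
  proof
    assume "fun_space.dependent (u ` I)"
    then obtain v c where v: "v \<in> u ` I" "c v \<noteq> 0" and sum: "(\<Sum>v\<in>u ` I. (\<lambda>x. c v * v x)) = 0"
      using fun_space.dependent_finite[of "u ` I"] assms(2) by auto
    have "(\<Sum>i\<in>I. c (u i) * u i x) = 0" for x
    proof -
      have "(\<Sum>i\<in>I. c (u i) * u i x) = (\<Sum>v\<in>u ` I. (\<lambda>x. c v * v x)) x"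
        by (simp add: sum.reindex[OF inj] sum_fun_eval)
      then show ?thesis
        by (simp add: sum)
    qed
    then have "\<forall>i\<in>I. c (u i) = 0"
      using zero[of "\<lambda>i. c (u i)"] by blast
    then show False
      using v by auto
  qed
  then have "card (u ` I) \<le> card B"
    using fun_space.independent_span_bound[OF assms(1)] u(1) by auto
  then show ?thesis
    by (simp add: card_image[OF inj])
qed

text \<open>Counting takes the place of transcendence degree. Polynomials only have to be
  expressible by \<open>hs\<close> on \<open>T\<close>, which may be an arbitrary set.\<close>

lemma krull_dim_le_generators:
  assumes gen: "\<And>p. p \<in> mat_poly_funs k \<Longrightarrow> \<exists>d. \<exists>u\<in>monomial_span hs d. \<forall>x\<in>T. p x = u x"
  shows "krull_dim (subtopology (zariski k S) T) \<le> ereal (real (length hs))"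
proof (rule krull_dim_le)
  fix m and Z :: "nat \<Rightarrow> complex mat set"
  let ?n = "length hs"
  assume chain: "\<forall>i\<le>m. closedin (subtopology (zariski k S) T) (Z i) \<and>
      irreducible_in (subtopology (zariski k S) T) (Z i)" "\<forall>i<m. Z i \<subset> Z (Suc i)"
  have ZT: "Z m \<subseteq> T"
    using chain(1) by (auto simp: irreducible_in_def)
  obtain gs where gs: "length gs = m" "set gs \<subseteq> mat_poly_funs k"
    and ind: "\<And>d. independent_on (Z m) (exps d m) (monomial gs)"
    using chain_independent[OF chain] by blast
  have "\<exists>us e. length us = length gs \<and> set us \<subseteq> monomial_span hs e \<and>
      (\<forall>js. \<forall>x\<in>T. monomial gs js x = monomial us js x)"
    using gs(2)
  proof (induction gs)
    case Nil
    show ?case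
      by auto
  next
    case (Cons g gs)
    then obtain us e where us: "length us = length gs" "set us \<subseteq> monomial_span hs e"
      "\<And>js x. x \<in> T \<Longrightarrow> monomial gs js x = monomial us js x"
      by auto
    obtain d u where u: "u \<in> monomial_span hs d" "\<And>x. x \<in> T \<Longrightarrow> g x = u x"
      using gen[of g] Cons.prems by auto
    have "monomial (g # gs) js x = monomial (u # us) js x" if "x \<in> T" for js x
      using us(3) u(2) that by (cases js) auto
    moreover have "set (u # us) \<subseteq> monomial_span hs (max d e)"
      using u(1) us(2) monomial_span_mono[of d "max d e" hs] monomial_span_mono[of e "max d e" hs]
      by auto
    ultimately show ?case
      using us(1) by (intro exI[of _ "u # us"] exI[of _ "max d e"]) simp
  qed
  then obtain us e where us: "length us = m" "set us \<subseteq> monomial_span hs e"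
    "\<And>js x. x \<in> T \<Longrightarrow> monomial gs js x = monomial us js x"
    using gs(1) by auto
  show "m \<le> ?n"
  proof (rule ccontr)
    assume "\<not> m \<le> ?n"
    \<comment> \<open>With \<open>n = length hs\<close>, the spanning set has at most
      \<open>((d + 1) (e m + 1)) ^ n = (d + 1) ^ n * d\<close> elements. This is less than
      \<open>(d + 1) ^ (n + 1)\<close>, hence than the number of independent monomials if
      \<open>m > n\<close>.\<close>
    define d where "d = (e * m + 1) ^ ?n"
    let ?B = "monomial hs ` exps (e * d * m) ?n"
    have "card (exps d m) \<le> card ?B"
    proof (rule card_le_of_independent_on_span[OF _ finite_exps _ ind])
      fix js assume "js \<in> exps d m"
      then have "monomial us js \<in> fun_space.span ?B"
        using monomial_span_monomial[OF us(2), of js d] us(1) by simp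
      then show "\<exists>u\<in>fun_space.span ?B. \<forall>x\<in>Z m. monomial gs js x = u x"
        using us(3) ZT by blast
    qed simp
    also have "\<dots> \<le> (e * d * m + 1) ^ ?n"
      using card_image_le[of "exps (e * d * m) ?n" "monomial hs"] by (simp add: card_exps)
    also have "\<dots> \<le> ((d + 1) * (e * m + 1)) ^ ?n"
      by (intro power_mono) (auto simp: algebra_simps)
    also have "\<dots> = (d + 1) ^ ?n * d"
      by (simp only: power_mult_distrib d_def)
    also have "\<dots> < (d + 1) ^ Suc ?n"
      by simp
    also have "\<dots> \<le> (d + 1) ^ m"
      using \<open>\<not> m \<le> ?n\<close> by (intro power_increasing) auto
    finally show False
      by (simp add: card_exps)
  qed
qed

section \<open>Coordinate subspaces of the Lie algebra\<close>

text \<open>Column \<open>j\<close> carries \<open>v_(j+1)\<close>. The whole space, the fibres and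
  the chains that bound dimensions from below are all of this form.\<close>

definition flat :: "nat \<Rightarrow> nat set \<Rightarrow> (nat \<Rightarrow> complex) \<Rightarrow> complex mat set" where
  "flat k B u = {X \<in> jet_lie k. \<forall>j\<in>B. X $$ (0, j) = u j}"

lemma closedin_flat:
  assumes "B \<subseteq> {..<k}"
  shows "closedin (zariski k (jet_lie k)) (flat k B u)"
  unfolding closedin_zariski
proof (intro exI conjI)
  let ?P = "(\<lambda>j X. X $$ (0, j) + - u j) ` B"
  show "?P \<subseteq> mat_poly_funs k"
    using assms by (intro image_subsetI mat_poly_funs.add[OF mat_poly_funs.entry mat_poly_funs.const]) auto
  show "flat k B u = {X \<in> jet_lie k. \<forall>p\<in>?P. p X = 0}"
    by (auto simp: flat_def)
qed

text \<open>A line joining a point outside \<open>A\<close> to a point outside \<open>C\<close> is not covered by \<open>A \<union> C\<close>.\<close>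
lemma irreducible_in_flat:
  assumes "B \<subseteq> {..<k}"
  shows "irreducible_in (zariski k (jet_lie k)) (flat k B u)"
  unfolding irreducible_in_def
proof (intro conjI allI impI)
  let ?X = "zariski k (jet_lie k)"
  show "flat k B u \<subseteq> topspace ?X"
    by (auto simp: flat_def)
  have "vf_mat k (Abs_fps (\<lambda>m. if m = 0 then 0 else u (m - 1))) \<in> flat k B u"
    using assms by (auto simp: flat_def vf_mat_in_jet_lie vf_mat_first_row)
  then show "flat k B u \<noteq> {}"
    by blast
  fix A C assume AC: "closedin ?X A \<and> closedin ?X C \<and> flat k B u \<subseteq> A \<union> C"
  then obtain P Q where P: "P \<subseteq> mat_poly_funs k" "A = {X \<in> jet_lie k. \<forall>p\<in>P. p X = 0}"
    and Q: "Q \<subseteq> mat_poly_funs k" "C = {X \<in> jet_lie k. \<forall>q\<in>Q. q X = 0}"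
    unfolding closedin_zariski by blast
  show "flat k B u \<subseteq> A \<or> flat k B u \<subseteq> C"
  proof (rule ccontr)
    assume "\<not> (flat k B u \<subseteq> A \<or> flat k B u \<subseteq> C)"
    then obtain a b where a: "a \<in> flat k B u" "a \<notin> A" and b: "b \<in> flat k B u" "b \<notin> C"
      by blast
    obtain p q where p: "p \<in> P" "p a \<noteq> 0" and q: "q \<in> Q" "q b \<noteq> 0"
      using a b P(2) Q(2) by (auto simp: flat_def)
    obtain V W where V: "a = vf_mat k V" "fps_nth V 0 = 0" and W: "b = vf_mat k W" "fps_nth W 0 = 0"
      using a(1) b(1) by (auto simp: flat_def jet_lie_eq)
    let ?L = "\<lambda>s. vf_mat k (V + fps_const s * (W - V))"
    have L: "?L s \<in> flat k B u" for s
    proof -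
      have "?L s \<in> jet_lie k"
        using V(2) W(2) by (intro vf_mat_in_jet_lie) simp
      moreover have "?L s $$ (0, j) = u j" if "j \<in> B" for j
      proof -
        have "j < k"
          using assms that by auto
        then have "fps_nth V (j + 1) = u j" "fps_nth W (j + 1) = u j"
          using a(1) b(1) that by (auto simp: flat_def V(1) W(1) vf_mat_first_row)
        then show ?thesis
          using \<open>j < k\<close> by (simp add: vf_mat_first_row)
      qed
      ultimately show ?thesis
        by (auto simp: flat_def)
    qed
    obtain p' q' where p': "\<And>s. p (?L s) = poly p' s" and q': "\<And>s. q (?L s) = poly q' s"
      using mat_poly_funs_line[of p k V "W - V"] mat_poly_funs_line[of q k V "W - V"] p(1) q(1) P(1) Q(1)
      by blast
    have "poly (p' * q') s = 0" for s
    proof -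
      have "?L s \<in> A \<or> ?L s \<in> C"
        using AC L[of s] by blast
      then show ?thesis
        using p(1) q(1) by (auto simp: P(2) Q(2) p' q')
    qed
    then have "p' * q' = 0"
      using poly_all_0_iff_0 by blast
    then have "p' = 0 \<or> q' = 0"
      by simp
    then show False
      using p'[of 0] q'[of 1] p(2) q(2) by (auto simp: V(1) W(1))
  qed
qed

text \<open>Only \<open>k - n\<close> coordinates are free: entries below the diagonal vanish, and
  those coming from the first \<open>n\<close> coordinates are constant. Arbitrary \<open>T\<close>
  admits orbits inside a fibre.\<close>

lemma krull_dim_le_flat:
  assumes T: "T \<subseteq> flat k {..<n} u"
  shows "krull_dim (subtopology (zariski k (jet_lie k)) T) \<le> ereal (real (k - n))"
proof -
  let ?hs = "map (\<lambda>j X. X $$ (0, j)) [n..<k] :: (complex mat \<Rightarrow> complex) list"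
  have "krull_dim (subtopology (zariski k (jet_lie k)) T) \<le> ereal (real (length ?hs))"
  proof (rule krull_dim_le_generators)
    fix p assume "p \<in> mat_poly_funs k"
    then show "\<exists>d. \<exists>v\<in>monomial_span ?hs d. \<forall>x\<in>T. p x = v x"
    proof induction
      case (const c)
      show ?case
        by (intro exI[of _ 0] bexI[OF _ monomial_span_const[of c]]) simp
    next
      case (entry i j)
      have val: "X $$ (i, j) = (if i \<le> j then of_nat (i + 1) * X $$ (0, j - i) else 0)" if "X \<in> T" for X
        using jet_lie_entry[OF _ entry] that T by (auto simp: flat_def)
      consider "j < i" | "i \<le> j" "j - i < n" | "i \<le> j" "n \<le> j - i"
        by linarith
      then show ?case
      proof cases
        case 1
        then show ?thesis
          using val by (intro exI[of _ 0] bexI[OF _ monomial_span_const[of 0]]) simp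
      next
        case 2
        then have "\<forall>X\<in>T. X $$ (i, j) = of_nat (i + 1) * u (j - i)"
          using val T by (auto simp: flat_def)
        then show ?thesis
          by (intro exI[of _ 0] bexI[OF _ monomial_span_const[of "of_nat (i + 1) * u (j - i)"]])
      next
        case 3
        then have "?hs ! (j - i - n) = (\<lambda>X. X $$ (0, j - i))"
          using entry by (simp add: nth_append)
        then have "(\<lambda>X. X $$ (0, j - i)) \<in> monomial_span ?hs 1"
          using monomial_span_nth[of "j - i - n" ?hs] entry 3 by simp
        from fun_space.span_scale[OF this, of "of_nat (i + 1)"]
        have mem: "(\<lambda>X. of_nat (i + 1) * X $$ (0, j - i)) \<in> monomial_span ?hs 1" .
        have "\<forall>X\<in>T. X $$ (i, j) = of_nat (i + 1) * X $$ (0, j - i)"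
          using val 3(1) by auto
        then show ?thesis
          by (intro exI[of _ 1] bexI[OF _ mem])
      qed
    next
      case (add f g)
      then obtain d v e w where v: "v \<in> monomial_span ?hs d" "\<forall>x\<in>T. f x = v x"
        and w: "w \<in> monomial_span ?hs e" "\<forall>x\<in>T. g x = w x"
        by blast
      have "v + w \<in> monomial_span ?hs (max d e)"
        using v(1) w(1) monomial_span_mono[of d "max d e" ?hs] monomial_span_mono[of e "max d e" ?hs]
        by (intro fun_space.span_add) auto
      then show ?case
        using v(2) w(2) by (intro exI[of _ "max d e"] bexI[of _ "v + w"]) auto
    next
      case (mult f g)
      then obtain d v e w where v: "v \<in> monomial_span ?hs d" "\<forall>x\<in>T. f x = v x"
        and w: "w \<in> monomial_span ?hs e" "\<forall>x\<in>T. g x = w x"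
        by blast
      show ?case
        using v(2) w(2) monomial_span_mult[OF v(1) w(1)]
        by (intro exI[of _ "d + e"] bexI[of _ "\<lambda>x. v x * w x"]) auto
    qed
  qed
  then show ?thesis
    by simp
qed

lemma krull_dim_flat:
  assumes "n \<le> k"
  shows "krull_dim (subtopology (zariski k (jet_lie k)) (flat k {..<n} u)) = ereal (real (k - n))"
proof (rule antisym[OF krull_dim_le_flat[OF subset_refl]])
  let ?X = "zariski k (jet_lie k)"
  let ?T = "flat k {..<n} u"
  \<comment> \<open>\<open>Z i\<close> frees the \<open>i\<close> coordinates from column
    \<open>n\<close> on and sets the later ones to 0, so the chain runs from a point to the whole
    flat in \<open>k - n\<close> steps.\<close>
  define Z where "Z i = flat k ({..<n} \<union> {n + i..<k}) (\<lambda>j. if j < n then u j else 0)" for i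
  have sub: "Z i \<subseteq> ?T" for i
    by (auto simp: Z_def flat_def)
  have B: "{..<n} \<union> {n + i..<k} \<subseteq> {..<k}" for i
    using assms by auto
  show "ereal (real (k - n)) \<le> krull_dim (subtopology ?X ?T)"
  proof (rule krull_dim_ge)
    show "closedin (subtopology ?X ?T) (Z i)" for i
      using closedin_flat[OF B] sub[of i] unfolding Z_def closedin_subtopology by blast
    show "irreducible_in (subtopology ?X ?T) (Z i)" for i
      using irreducible_in_subtopology[OF irreducible_in_flat[OF B]] sub unfolding Z_def by blast
    show "Z i \<subset> Z (Suc i)" if i: "i < k - n" for i
    proof
      show "Z i \<subseteq> Z (Suc i)"
        by (auto simp: Z_def flat_def)
      \<comment> \<open>The coordinate in column \<open>n + i\<close>, which is the coefficient
        \<open>n + i + 1\<close>, is 1 here but 0 on \<open>Z i\<close>.\<close>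
      let ?V = "Abs_fps (\<lambda>m. if m = 0 then 0 else if m \<le> n then u (m - 1) else if m = n + i + 1 then 1 else 0)"
      have "vf_mat k ?V \<in> Z (Suc i)"
        using assms by (auto simp: Z_def flat_def vf_mat_in_jet_lie vf_mat_first_row)
      moreover have "vf_mat k ?V \<notin> Z i"
        using i by (auto simp: Z_def flat_def vf_mat_first_row intro!: bexI[of _ "n + i"])
      ultimately show "Z i \<noteq> Z (Suc i)"
        by blast
    qed
  qed
qed

lemma dim_jet_lie: "krull_dim (zariski k (jet_lie k)) = ereal (real k)"
proof -
  have "flat k {..<0} (\<lambda>_. 0) = topspace (zariski k (jet_lie k))"
    by (simp add: flat_def)
  then have "subtopology (zariski k (jet_lie k)) (flat k {..<0} (\<lambda>_. 0)) = zariski k (jet_lie k)"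
    by (simp only: subtopology_topspace)
  then show ?thesis
    using krull_dim_flat[of 0 k "\<lambda>_. 0"] by simp
qed

lemma level_set_eq_flat: "{X \<in> jet_lie k. X $$ (0, 0) = c} = flat k {..<1} (\<lambda>_. c)"
  by (auto simp: flat_def)

section \<open>The ideal of the null cone\<close>

text \<open>Serves for the ideal of the null cone and, with a single point as \<open>Z\<close>, for
  the ideals of points of the quotient.\<close>

lemma ideal_vanishing:
  assumes F: "fun_subalgebra S F" and Z: "Z \<subseteq> S"
  shows "ideal {f \<in> F. \<forall>z\<in>Z. f z = 0} (fun_alg S F)"
proof -
  interpret cring "fun_alg S F"
    by (rule fun_alg_cring[OF F])
  let ?I = "{f \<in> F. \<forall>z\<in>Z. f z = 0}"
  note closed = fun_subalgebraD[OF F]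
  have neg: "\<ominus>\<^bsub>fun_alg S F\<^esub> f = (\<lambda>x\<in>S. - 1 * f x)" if "f \<in> F" for f
    using that fun_subalgebra_scale[OF F that, of "-1"]
    by (intro minus_equality) (auto simp: fun_alg_def)
  show ?thesis
  proof (rule idealI[OF ring_axioms])
    show "subgroup ?I (add_monoid (fun_alg S F))"
    proof
      fix f assume f: "f \<in> ?I"
      then have "(\<lambda>x\<in>S. - 1 * f x) \<in> ?I"
        using fun_subalgebra_scale[OF F, of f "-1"] Z by auto
      then show "inv\<^bsub>add_monoid (fun_alg S F)\<^esub> f \<in> ?I"
        using neg[of f] f by (simp add: a_inv_def)
    qed (use Z closed in \<open>auto simp: fun_alg_def subset_iff\<close>)
  qed (use Z closed in \<open>auto simp: fun_alg_def subset_iff\<close>)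
qed

text \<open>Division with remainder by \<open>v_1\<close>: the projection that sets
  \<open>v_1\<close> to 0 lands in the null cone and changes \<open>p\<close> by a multiple of
  \<open>v_1\<close>.\<close>

lemma mat_poly_funs_mod_weight:
  assumes "k \<ge> 1" "p \<in> mat_poly_funs k"
  shows "\<exists>g\<in>mat_poly_funs k. \<forall>X\<in>jet_lie k. \<exists>Y\<in>null_cone k. p X = p Y + X $$ (0, 0) * g X"
proof -
  define \<pi> where "\<pi> X = vf_mat k (Abs_fps (\<lambda>m. if m \<le> 1 then 0 else X $$ (0, m - 1)))" for X :: "complex mat"
  have \<pi>: "\<pi> X \<in> jet_lie k" for X
    by (simp add: \<pi>_def vf_mat_in_jet_lie)
  have row: "\<pi> X $$ (0, j) = (if j = 0 then 0 else X $$ (0, j))" if "j < k" for X j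
    using that by (simp add: \<pi>_def vf_mat_first_row)
  have "\<exists>g\<in>mat_poly_funs k. \<forall>X\<in>jet_lie k. p X = p (\<pi> X) + X $$ (0, 0) * g X"
    using assms(2)
  proof induction
    case (const c)
    show ?case
      using mat_poly_funs.const[of 0 k] by force
  next
    case (entry i j)
    \<comment> \<open>Only diagonal entries involve \<open>v_1\<close>; the entry
      \<open>(i, i)\<close> is \<open>(i + 1) v_1\<close>.\<close>
    let ?c = "if i = j then of_nat (i + 1) else 0 :: complex"
    have "X $$ (i, j) = \<pi> X $$ (i, j) + X $$ (0, 0) * ?c" if "X \<in> jet_lie k" for X
      unfolding jet_lie_entry[OF that entry] jet_lie_entry[OF \<pi> entry]
      using entry row[of "j - i" X] by auto
    then show ?case
      by (intro bexI[OF _ mat_poly_funs.const[of ?c]] ballI)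
  next
    case (add f g)
    then obtain f' g' where "f' \<in> mat_poly_funs k" "\<forall>X\<in>jet_lie k. f X = f (\<pi> X) + X $$ (0, 0) * f' X"
      "g' \<in> mat_poly_funs k" "\<forall>X\<in>jet_lie k. g X = g (\<pi> X) + X $$ (0, 0) * g' X"
      by blast
    then show ?case
      by (intro bexI[of _ "\<lambda>X. f' X + g' X"] mat_poly_funs.add) (auto simp: algebra_simps)
  next
    case (mult f g)
    then obtain f' g' where f': "f' \<in> mat_poly_funs k" "\<And>X. X \<in> jet_lie k \<Longrightarrow> f (\<pi> X) = f X - X $$ (0, 0) * f' X"
      and g': "g' \<in> mat_poly_funs k" "\<And>X. X \<in> jet_lie k \<Longrightarrow> g (\<pi> X) = g X - X $$ (0, 0) * g' X"
      by (metis add_diff_cancel_right')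
    \<comment> \<open>From \<open>f g - (f - x f') (g - x g') = x (f g' + f' (g - x g'))\<close>
      with \<open>x = v_1\<close>. Subtraction is written with the factor -1 because
      \<open>mat_poly_funs\<close> is generated by sums and products.\<close>
    let ?h = "\<lambda>X. f X * g' X + f' X * (g X + - 1 * (X $$ (0, 0) * g' X))"
    have h: "?h \<in> mat_poly_funs k"
      using mult.hyps f'(1) g'(1) assms(1) by (intro mat_poly_funs.intros) auto
    have "f X * g X = f (\<pi> X) * g (\<pi> X) + X $$ (0, 0) * ?h X" if "X \<in> jet_lie k" for X
      unfolding f'(2)[OF that] g'(2)[OF that] by (simp add: algebra_simps)
    then show ?case
      by (intro bexI[OF _ h] ballI)
  qed
  then obtain g where g: "g \<in> mat_poly_funs k"
    "\<And>X. X \<in> jet_lie k \<Longrightarrow> p X = p (\<pi> X) + X $$ (0, 0) * g X"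
    by blast
  have nc: "\<pi> X \<in> null_cone k" for X
    using \<pi> row[of 0 X] assms(1) by (simp add: null_cone_eq[OF assms(1)])
  show ?thesis
    by (intro bexI[OF _ g(1)] ballI) (use g(2) nc in blast)
qed

text \<open>If \<open>p\<close> vanishes on the null cone, so does its remainder modulo
  \<open>v_1\<close>, and \<open>p\<close> is a multiple of \<open>v_1\<close>. The equation
  \<open>v_1 = 0\<close> thus generates the full ideal and not merely one with the same zero
  set.\<close>

lemma vanishing_ideal_null_cone:
  assumes "k \<ge> 1"
  shows "vanishing_ideal k (jet_lie k) (null_cone k) =
    Idl\<^bsub>fun_alg (jet_lie k) (coord_funs k (jet_lie k))\<^esub> {\<lambda>X\<in>jet_lie k. X $$ (0, 0)}"
proof -
  let ?S = "jet_lie k"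
  let ?F = "coord_funs k ?S"
  let ?x = "\<lambda>X\<in>?S. X $$ (0, 0)"
  note F = fun_subalgebra_coord_funs[of ?S k]
  interpret cring "fun_alg ?S ?F"
    by (rule fun_alg_cring[OF F])
  have x: "?x \<in> ?F"
    using assms by (intro entry_in_coord_funs) auto
  then have xc: "{?x} \<subseteq> carrier (fun_alg ?S ?F)"
    by (simp add: fun_alg_def)
  have nc: "null_cone k \<subseteq> ?S"
    by (auto simp: null_cone_eq[OF assms])
  show ?thesis
  proof
    show "vanishing_ideal k ?S (null_cone k) \<subseteq> Idl\<^bsub>fun_alg ?S ?F\<^esub> {?x}"
    proof
      fix f assume "f \<in> vanishing_ideal k ?S (null_cone k)"
      then obtain p where p: "p \<in> mat_poly_funs k" "f = restrict p ?S"
        and f: "\<And>z. z \<in> null_cone k \<Longrightarrow> f z = 0"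
        by (auto simp: vanishing_ideal_def coord_funs_def)
      obtain g where g: "g \<in> mat_poly_funs k"
        "\<And>X. X \<in> ?S \<Longrightarrow> \<exists>Y\<in>null_cone k. p X = p Y + X $$ (0, 0) * g X"
        using mat_poly_funs_mod_weight[OF assms p(1)] by blast
      have zero: "p Y = 0" if "Y \<in> null_cone k" for Y
        using f[OF that] nc that p(2) by auto
      have "f X = X $$ (0, 0) * g X" if "X \<in> ?S" for X
        using g(2)[OF that] zero that p(2) by auto
      then have "f = restrict g ?S \<otimes>\<^bsub>fun_alg ?S ?F\<^esub> ?x"
        using p(2) by (auto simp: fun_alg_def fun_eq_iff)
      moreover have "restrict g ?S \<in> carrier (fun_alg ?S ?F)"
        using g(1) by (auto simp: fun_alg_def coord_funs_def)
      ultimately show "f \<in> Idl\<^bsub>fun_alg ?S ?F\<^esub> {?x}"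
        using ideal.I_l_closed[OF genideal_ideal[OF xc]] genideal_self[OF xc] by simp
    qed
    have "ideal (vanishing_ideal k ?S (null_cone k)) (fun_alg ?S ?F)"
      unfolding vanishing_ideal_def by (rule ideal_vanishing[OF F nc])
    moreover have "{?x} \<subseteq> vanishing_ideal k ?S (null_cone k)"
      using x by (auto simp: vanishing_ideal_def null_cone_eq[OF assms])
    ultimately show "Idl\<^bsub>fun_alg ?S ?F\<^esub> {?x} \<subseteq> vanishing_ideal k ?S (null_cone k)"
      by (rule genideal_minimal)
  qed
qed

section \<open>The algebra of invariants\<close>

lemma inv_alg_eq: "k \<ge> 1 \<Longrightarrow> inv_alg k = fun_alg (jet_lie k) (range (weight_fun k))"
  by (simp add: inv_alg_def inv_funs_eq)

lemma inv_alg_ops: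
  assumes "k \<ge> 1"
  shows "carrier (inv_alg k) = range (weight_fun k)"
    "weight_fun k p \<otimes>\<^bsub>inv_alg k\<^esub> weight_fun k q = weight_fun k (p * q)"
    "weight_fun k p \<oplus>\<^bsub>inv_alg k\<^esub> weight_fun k q = weight_fun k (p + q)"
    "\<one>\<^bsub>inv_alg k\<^esub> = weight_fun k 1"
    "\<zero>\<^bsub>inv_alg k\<^esub> = weight_fun k 0"
  unfolding weight_fun_add weight_fun_mult inv_alg_eq[OF assms]
  by (auto simp: fun_alg_def weight_fun_def)

lemma cring_inv_alg: "k \<ge> 1 \<Longrightarrow> cring (inv_alg k)"
  unfolding inv_alg_eq by (rule fun_alg_cring[OF fun_subalgebra_range_weight_fun])

section \<open>The polynomial ring in one variable\<close>

text \<open>All variables except \<open>y_0\<close> are set to 1. This is a ring homomorphism on the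
  whole type and becomes bijective on \<open>carrier (poly_ring 1)\<close>, where no other variable
  occurs.\<close>

definition univariate :: "((nat \<Rightarrow>\<^sub>0 nat) \<Rightarrow>\<^sub>0 complex) \<Rightarrow> complex poly" where
  "univariate p = (\<Sum>m\<in>Poly_Mapping.keys p. monom (Poly_Mapping.lookup p m) (Poly_Mapping.lookup m 0))"

lemma univariate_add: "univariate (p + q) = univariate p + univariate q"
  unfolding univariate_def by (rule setsum_keys_plus_distrib) (simp_all add: add_monom)

lemma univariate_0 [simp]: "univariate 0 = 0"
  by (simp add: univariate_def)

lemma univariate_sum: "univariate (\<Sum>i\<in>I. f i) = (\<Sum>i\<in>I. univariate (f i))"
  by (induction I rule: infinite_finite_induct) (simp_all add: univariate_add)

lemma univariate_single: "univariate (Poly_Mapping.single m a) = monom a (Poly_Mapping.lookup m 0)"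
  by (simp add: univariate_def)

lemma poly_mapping_eq_sum_single:
  "p = (\<Sum>m\<in>Poly_Mapping.keys p. Poly_Mapping.single m (Poly_Mapping.lookup p m))"
proof (rule poly_mapping_eqI)
  fix m
  have "Poly_Mapping.lookup (\<Sum>m\<in>Poly_Mapping.keys p. Poly_Mapping.single m (Poly_Mapping.lookup p m)) m =
      (\<Sum>l\<in>Poly_Mapping.keys p. if l = m then Poly_Mapping.lookup p l else 0)"
    by (simp add: lookup_sum lookup_single when_def)
  also have "\<dots> = Poly_Mapping.lookup p m"
    by (simp add: sum.delta in_keys_iff)
  finally show "Poly_Mapping.lookup p m = Poly_Mapping.lookup
      (\<Sum>m\<in>Poly_Mapping.keys p. Poly_Mapping.single m (Poly_Mapping.lookup p m)) m" ..
qed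

lemma univariate_mult: "univariate (p * q) = univariate p * univariate q"
proof -
  let ?s = "\<lambda>p m. Poly_Mapping.single m (Poly_Mapping.lookup p m) :: (nat \<Rightarrow>\<^sub>0 nat) \<Rightarrow>\<^sub>0 complex"
  have "p * q = (\<Sum>m\<in>Poly_Mapping.keys p. ?s p m) * (\<Sum>n\<in>Poly_Mapping.keys q. ?s q n)"
    using poly_mapping_eq_sum_single[of p] poly_mapping_eq_sum_single[of q] by simp
  also have "\<dots> = (\<Sum>m\<in>Poly_Mapping.keys p. \<Sum>n\<in>Poly_Mapping.keys q. ?s p m * ?s q n)"
    by (rule sum_product)
  finally have "univariate (p * q) =
      (\<Sum>m\<in>Poly_Mapping.keys p. \<Sum>n\<in>Poly_Mapping.keys q. univariate (?s p m * ?s q n))"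
    by (simp only: univariate_sum)
  also have "\<dots> = univariate p * univariate q"
    by (simp add: univariate_def[of p] univariate_def[of q] sum_product mult_single univariate_single
        lookup_add mult_monom)
  finally show ?thesis .
qed

lemma coeff_univariate:
  assumes "p \<in> carrier (poly_ring 1)"
  shows "coeff (univariate p) n = Poly_Mapping.lookup p (Poly_Mapping.single 0 n)"
proof -
  have eq: "Poly_Mapping.lookup m 0 = n \<longleftrightarrow> m = Poly_Mapping.single 0 n" if "m \<in> Poly_Mapping.keys p" for m
  proof
    assume n: "Poly_Mapping.lookup m 0 = n"
    show "m = Poly_Mapping.single 0 n"
    proof (rule poly_mapping_eqI)
      fix i
      have "Poly_Mapping.keys m \<subseteq> {..<1}"
        using assms that by (auto simp: poly_ring_def)
      then have "Poly_Mapping.lookup m i = 0" if "i \<noteq> 0"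
        using that by (meson in_keys_iff lessThan_iff less_one subsetD)
      then show "Poly_Mapping.lookup m i = Poly_Mapping.lookup (Poly_Mapping.single 0 n) i"
        using n by (cases "i = 0") (auto simp: lookup_single)
    qed
  qed simp
  have "coeff (univariate p) n =
      (\<Sum>m\<in>Poly_Mapping.keys p. if m = Poly_Mapping.single 0 n then Poly_Mapping.lookup p m else 0)"
    unfolding univariate_def coeff_sum by (intro sum.cong) (simp_all add: eq)
  also have "\<dots> = Poly_Mapping.lookup p (Poly_Mapping.single 0 n)"
    by (simp add: sum.delta in_keys_iff)
  finally show ?thesis .
qed

lemma bij_betw_univariate: "bij_betw univariate (carrier (poly_ring 1)) UNIV"
proof (rule bij_betw_imageI)
  show "inj_on univariate (carrier (poly_ring 1))"
  proof (rule inj_onI)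
    fix p q assume p: "p \<in> carrier (poly_ring 1)" and q: "q \<in> carrier (poly_ring 1)"
      and eq: "univariate p = univariate q"
    have single: "Poly_Mapping.lookup p (Poly_Mapping.single 0 n) = Poly_Mapping.lookup q (Poly_Mapping.single 0 n)" for n
      using coeff_univariate[OF p, of n] coeff_univariate[OF q, of n] eq by simp
    show "p = q"
    proof (rule poly_mapping_eqI)
      fix m
      show "Poly_Mapping.lookup p m = Poly_Mapping.lookup q m"
      proof (cases "Poly_Mapping.keys m \<subseteq> {..<1}")
        case True
        have "m = Poly_Mapping.single 0 (Poly_Mapping.lookup m 0)"
        proof (rule poly_mapping_eqI)
          fix i
          show "Poly_Mapping.lookup m i = Poly_Mapping.lookup (Poly_Mapping.single 0 (Poly_Mapping.lookup m 0)) i"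
            using True by (cases "i = 0") (auto simp: lookup_single in_keys_iff)
        qed
        then show ?thesis
          using single by metis
      next
        case False
        then have "m \<notin> Poly_Mapping.keys p" "m \<notin> Poly_Mapping.keys q"
          using p q by (auto simp: poly_ring_def)
        then show ?thesis
          by (simp add: in_keys_iff)
      qed
    qed
  qed
  have "r \<in> univariate ` carrier (poly_ring 1)" for r
  proof
    let ?p = "\<Sum>i\<le>degree r. Poly_Mapping.single (Poly_Mapping.single 0 i) (coeff r i)
      :: (nat \<Rightarrow>\<^sub>0 nat) \<Rightarrow>\<^sub>0 complex"
    show "r = univariate ?p"
      by (simp add: univariate_sum univariate_single poly_as_sum_of_monoms)
    have sub: "Poly_Mapping.keys ?p \<subseteq>
        (\<Union>i\<in>{..degree r}. Poly_Mapping.keys (Poly_Mapping.single (Poly_Mapping.single 0 i) (coeff r i)))"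
      by (rule keys_sum)
    have "Poly_Mapping.keys m \<subseteq> {..<1}" if m: "m \<in> Poly_Mapping.keys ?p" for m
    proof -
      obtain i where "m = Poly_Mapping.single 0 i"
        using subsetD[OF sub m] by (auto split: if_splits)
      then show ?thesis
        by simp
    qed
    then show "?p \<in> carrier (poly_ring 1)"
      by (simp add: poly_ring_def)
  qed
  then show "univariate ` carrier (poly_ring 1) = UNIV"
    by blast
qed

lemma is_polynomial_algebra_inv_alg:
  assumes "k \<ge> 1"
  shows "is_polynomial_algebra (inv_alg k) (\<lambda>c. \<lambda>x\<in>jet_lie k. c)"
  unfolding is_polynomial_algebra_def
proof (intro exI bexI allI)
  let ?\<phi> = "\<lambda>p. weight_fun k (univariate p)"
  show "?\<phi> (Poly_Mapping.single 0 c) = (\<lambda>x\<in>jet_lie k. c)" for c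
    by (simp add: univariate_single monom_0 weight_fun_const)
  have "inj (weight_fun k)"
    using weight_fun_inject[OF assms] by (auto intro: injI)
  then have "bij_betw (weight_fun k) UNIV (range (weight_fun k))"
    by (rule inj_on_imp_bij_betw)
  from bij_betw_trans[OF bij_betw_univariate this]
  have bij: "bij_betw ?\<phi> (carrier (poly_ring 1)) (carrier (inv_alg k))"
    by (simp add: comp_def inv_alg_ops(1)[OF assms])
  have "univariate 1 = 1"
    using univariate_single[of 0 1] by simp
  then show "?\<phi> \<in> ring_iso (poly_ring 1) (inv_alg k)"
    by (intro ring_iso_memI bij)
      (simp_all add: inv_alg_ops[OF assms] univariate_add univariate_mult poly_ring_def)
qed

section \<open>The spectrum of the invariants\<close>

lemma primeideal_weight_ideal:
  assumes "k \<ge> 1"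
  shows "primeideal (weight_ideal k c) (inv_alg k)"
proof (rule primeidealI[OF _ cring_inv_alg[OF assms]])
  obtain X where X: "X \<in> jet_lie k" "X $$ (0, 0) = c"
    using weight_attained[OF assms] by blast
  have "weight_ideal k c = {f \<in> range (weight_fun k). \<forall>z\<in>{X}. f z = 0}"
    using X by (auto simp: weight_ideal_def weight_fun_apply)
  then show "ideal (weight_ideal k c) (inv_alg k)"
    using ideal_vanishing[OF fun_subalgebra_range_weight_fun, of "{X}" k] X(1)
    by (simp only: inv_alg_eq[OF assms]) simp
  show "carrier (inv_alg k) \<noteq> weight_ideal k c"
    using weight_fun_in_weight_ideal[OF assms, of 1 c] inv_alg_ops(1)[OF assms] by auto
  fix f g assume "f \<in> carrier (inv_alg k)" "g \<in> carrier (inv_alg k)" "f \<otimes>\<^bsub>inv_alg k\<^esub> g \<in> weight_ideal k c"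
  then show "f \<in> weight_ideal k c \<or> g \<in> weight_ideal k c"
    by (auto simp: inv_alg_ops[OF assms] weight_fun_in_weight_ideal[OF assms])
qed

lemma primeideal_zero:
  assumes "k \<ge> 1"
  shows "primeideal {weight_fun k 0} (inv_alg k)"
proof (rule primeidealI[OF _ cring_inv_alg[OF assms]])
  interpret cring "inv_alg k"
    by (rule cring_inv_alg[OF assms])
  show "ideal {weight_fun k 0} (inv_alg k)"
    using zeroideal by (simp add: inv_alg_ops[OF assms])
  have "weight_fun k 1 \<noteq> weight_fun k 0"
    by (simp add: weight_fun_inject[OF assms])
  then show "carrier (inv_alg k) \<noteq> {weight_fun k 0}"
    unfolding inv_alg_ops(1)[OF assms] by blast
  fix f g assume "f \<in> carrier (inv_alg k)" "g \<in> carrier (inv_alg k)" "f \<otimes>\<^bsub>inv_alg k\<^esub> g \<in> {weight_fun k 0}"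
  then show "f \<in> {weight_fun k 0} \<or> g \<in> {weight_fun k 0}"
    by (auto simp: inv_alg_ops[OF assms] weight_fun_inject[OF assms])
qed

text \<open>A nonzero polynomial in a prime ideal splits into linear factors, one of which lies in
  the ideal; its root \<open>c\<close> determines the ideal.\<close>

lemma primeideal_inv_alg_cases:
  assumes "k \<ge> 1" "primeideal P (inv_alg k)"
  obtains "P = {weight_fun k 0}" | c where "P = weight_ideal k c"
proof (cases "P = {weight_fun k 0}")
  case False
  interpret primeideal P "inv_alg k"
    by (rule assms(2))
  note ops = inv_alg_ops[OF assms(1)]
  have closed: "weight_fun k (p * q) \<in> P" if "weight_fun k p \<in> P" for p q
    using I_r_closed[OF that, of "weight_fun k q"] by (simp add: ops)
  have unit: "weight_fun k [:a:] \<notin> P" if "a \<noteq> 0" for a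
  proof
    assume "weight_fun k [:a:] \<in> P"
    then have "weight_fun k ([:a:] * (smult (inverse a) q)) \<in> P" for q
      by (rule closed)
    then have "range (weight_fun k) \<subseteq> P"
      using that by (auto simp: image_subset_iff)
    then show False
      using I_notcarr a_subset by (simp add: ops)
  qed
  \<comment> \<open>Each step splits off one root by the fundamental theorem of algebra. Degree 0 is
    impossible because nonzero constants are units.\<close>
  have root: "\<exists>c. weight_fun k [:- c, 1:] \<in> P" if "weight_fun k q \<in> P" "q \<noteq> 0" for q
    using that
  proof (induction "degree q" arbitrary: q)
    case 0
    then obtain a where "q = [:a:]"
      using degree_eq_zeroE by metis
    then show ?case
      using unit 0 by auto
  next
    case (Suc n)
    then have "\<not> constant (poly q)"
      by (simp add: constant_degree)
    then obtain c where "poly q c = 0"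
      using fundamental_theorem_of_algebra by blast
    then obtain r where r: "q = [:- c, 1:] * r"
      by (metis dvdE poly_eq_0_iff_dvd)
    with Suc.prems have "r \<noteq> 0" "degree r = n"
      using Suc.hyps(2) by (auto simp: degree_mult_eq simp del: mult_pCons_left)
    moreover have "weight_fun k [:- c, 1:] \<in> P \<or> weight_fun k r \<in> P"
      using I_prime[of "weight_fun k [:- c, 1:]" "weight_fun k r"] Suc.prems(1)
      by (simp add: ops r del: mult_pCons_left)
    ultimately show ?case
      using Suc.hyps(1)[of r] by blast
  qed
  have "weight_fun k 0 \<in> P"
    using additive_subgroup.zero_closed[OF additive_subgroup_axioms] by (simp add: ops)
  then obtain f where "f \<in> P" "f \<noteq> weight_fun k 0"
    using False by blast
  then obtain q where "weight_fun k q \<in> P" "q \<noteq> 0"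
    using a_subset unfolding ops by blast
  then obtain c where c: "weight_fun k [:- c, 1:] \<in> P"
    using root by blast
  have "P = weight_ideal k c"
  proof
    show "weight_ideal k c \<subseteq> P"
    proof
      fix f assume "f \<in> weight_ideal k c"
      then obtain q where "f = weight_fun k q" "poly q c = 0"
        by (auto simp: weight_ideal_def)
      then show "f \<in> P"
        using closed[OF c] by (metis dvdE poly_eq_0_iff_dvd)
    qed
    show "P \<subseteq> weight_ideal k c"
    proof
      fix f assume f: "f \<in> P"
      then obtain q where q: "f = weight_fun k q"
        using a_subset unfolding ops by blast
      \<comment> \<open>Modulo the linear polynomial, \<open>q\<close> is the constant
        \<open>poly q c\<close>; this constant lies in \<open>P\<close> and so must be 0.\<close>
      have "[:- c, 1:] dvd q - [:poly q c:]"
        by (simp add: poly_eq_0_iff_dvd[symmetric])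
      then obtain r where eq: "q - [:poly q c:] = [:- c, 1:] * r" ..
      have r: "[:poly q c:] = q + [:- c, 1:] * (- r)"
        by (simp only: mult_minus_right flip: eq) simp
      have "weight_fun k q \<oplus>\<^bsub>inv_alg k\<^esub> weight_fun k ([:- c, 1:] * (- r)) \<in> P"
        using f closed[OF c, of "- r"] unfolding q
        by (rule additive_subgroup.a_closed[OF additive_subgroup_axioms])
      then have "weight_fun k [:poly q c:] \<in> P"
        unfolding ops r .
      then show "f \<in> weight_ideal k c"
        using unit by (auto simp: q weight_ideal_def)
    qed
  qed
  then show ?thesis
    using that by blast
qed (use that in blast)

text \<open>Maximal ideals are prime, and the zero ideal is properly contained in
  \<open>weight_ideal k 0\<close>. Equidimensionality is thereby a statement about the level sets of
  \<open>v_1\<close>.\<close>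

lemma closed_points_inv_alg:
  assumes "k \<ge> 1" "P \<in> closed_points (inv_alg k)"
  obtains c where "P = weight_ideal k c"
proof -
  interpret R: cring "inv_alg k"
    by (rule cring_inv_alg[OF assms(1)])
  have max: "maximalideal P (inv_alg k)"
    using assms(2) by (simp add: closed_points_def)
  have "P \<noteq> {weight_fun k 0}"
  proof
    assume P: "P = {weight_fun k 0}"
    interpret W: primeideal "weight_ideal k 0" "inv_alg k"
      by (rule primeideal_weight_ideal[OF assms(1)])
    have "weight_fun k [:0, 1:] \<in> weight_ideal k 0" "weight_fun k 0 \<in> weight_ideal k 0"
      by (simp_all add: weight_fun_in_weight_ideal[OF assms(1)])
    then show False
      using maximalideal.I_maximal[OF max W.is_ideal] W.I_notcarr W.a_subset
      by (auto simp: P weight_fun_inject[OF assms(1)])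
  qed
  then show ?thesis
    using primeideal_inv_alg_cases[OF assms(1) R.maximalideal_prime[OF max]] that by metis
qed

section \<open>Topology and dimension of the spectrum\<close>

lemma closedin_spec:
  "closedin (spec_topology R) C \<longleftrightarrow> (\<exists>E\<subseteq>carrier R. C = {P \<in> spec R. E \<subseteq> P})"
proof -
  have openin: "openin (spec_topology R) U \<longleftrightarrow> (\<exists>E\<subseteq>carrier R. U = {P \<in> spec R. \<not> E \<subseteq> P})" for U
    unfolding spec_topology_def by (simp add: topology_inverse'[OF istopology_spec])
  have top: "topspace (spec_topology R) = spec R"
  proof
    show "topspace (spec_topology R) \<subseteq> spec R"
      unfolding topspace_def openin by blast
    have "\<not> carrier R \<subseteq> P" if "P \<in> spec R" for P
    proof -
      interpret primeideal P R
        using that by (simp add: spec_def)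
      show ?thesis
        using I_notcarr a_subset by blast
    qed
    then have "openin (spec_topology R) (spec R)"
      unfolding openin by blast
    then show "spec R \<subseteq> topspace (spec_topology R)"
      by (rule openin_subset)
  qed
  show ?thesis
  proof
    assume "closedin (spec_topology R) C"
    then obtain E where "C \<subseteq> spec R" "E \<subseteq> carrier R" "spec R - C = {P \<in> spec R. \<not> E \<subseteq> P}"
      unfolding closedin_def top openin by blast
    then show "\<exists>E\<subseteq>carrier R. C = {P \<in> spec R. E \<subseteq> P}"
      by (intro exI[of _ E]) blast
  next
    assume "\<exists>E\<subseteq>carrier R. C = {P \<in> spec R. E \<subseteq> P}"
    then show "closedin (spec_topology R) C"
      unfolding closedin_def top openin by blast
  qed
qed

lemma topspace_spec: "spec R \<subseteq> topspace (spec_topology R)"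
proof -
  have "closedin (spec_topology R) (spec R)"
    unfolding closedin_spec by (intro exI[of _ "{}"]) auto
  then show ?thesis
    by (rule closedin_subset)
qed

text \<open>The zero ideal is a generic point: a closed set containing it is the whole spectrum. A
  proper irreducible closed set is a single closed point, so chains have at most one step.\<close>

lemma dim_quot_eq:
  assumes "k \<ge> 1"
  shows "krull_dim (spec_topology (inv_alg k)) = ereal (real 1)"
proof (rule antisym)
  let ?R = "inv_alg k"
  let ?X = "spec_topology ?R"
  note in_weight = weight_fun_in_weight_ideal[OF assms]
  have gen: "{weight_fun k 0} \<in> spec ?R"
    using primeideal_zero[OF assms] by (simp add: spec_def)
  have point: "weight_ideal k c \<in> spec ?R" for c
    using primeideal_weight_ideal[OF assms] by (simp add: spec_def)
  have whole: "C = spec ?R" if C: "closedin ?X C" "{weight_fun k 0} \<in> C" for C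
  proof -
    obtain E where "E \<subseteq> carrier ?R" "C = {P \<in> spec ?R. E \<subseteq> P}"
      using C(1) unfolding closedin_spec by blast
    moreover have "weight_fun k 0 \<in> P" if "P \<in> spec ?R" for P
    proof -
      interpret primeideal P ?R
        using that by (simp add: spec_def)
      show ?thesis
        using additive_subgroup.zero_closed[OF additive_subgroup_axioms] by (simp add: inv_alg_ops[OF assms])
    qed
    ultimately show ?thesis
      using C(2) by auto
  qed
  have sub_spec: "C \<subseteq> spec ?R" if "closedin ?X C" for C
    using that unfolding closedin_spec by blast
  show "krull_dim ?X \<le> ereal (real 1)"
  proof (rule krull_dim_le)
    fix n and Z :: "nat \<Rightarrow> (complex mat \<Rightarrow> complex) set set"
    assume Z: "\<forall>i\<le>n. closedin ?X (Z i) \<and> irreducible_in ?X (Z i)" "\<forall>i<n. Z i \<subset> Z (Suc i)"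
    show "n \<le> 1"
    proof (rule ccontr)
      assume "\<not> n \<le> 1"
      then have cl: "closedin ?X (Z 0)" "closedin ?X (Z 1)" "closedin ?X (Z 2)"
        and irr: "irreducible_in ?X (Z 0)" "irreducible_in ?X (Z 1)"
        and sub: "Z 0 \<subset> Z 1" "Z 1 \<subset> Z 2"
        using Z by (auto simp: numeral_2_eq_2)
      \<comment> \<open>\<open>Z 1\<close> lies strictly inside \<open>Z 2\<close>, hence is not the
        whole spectrum.\<close>
      have nongen: "{weight_fun k 0} \<notin> Z 1"
        using whole[OF cl(2)] sub_spec[OF cl(3)] sub(2) by blast
      have points: "\<exists>c. P = weight_ideal k c" if "P \<in> Z 1" for P
        using primeideal_inv_alg_cases[OF assms, of P] that nongen sub_spec[OF cl(2)]
        by (auto simp: spec_def)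
      obtain P Q where P: "P \<in> Z 0" and Q: "Q \<in> Z 1" "Q \<notin> Z 0"
        using irr(1) sub(1) by (auto simp: irreducible_in_def)
      obtain c d where cd: "P = weight_ideal k c" "Q = weight_ideal k d"
        using points[of P] points[OF Q(1)] P sub(1) by blast
      have "c \<noteq> d"
        using P Q(2) cd by blast
      obtain E where E: "E \<subseteq> carrier ?R" "Z 1 = {P \<in> spec ?R. E \<subseteq> P}"
        using cl(2) unfolding closedin_spec by blast
      then obtain f where f: "f \<in> E" "f \<noteq> weight_fun k 0"
        using nongen gen by blast
      then obtain q where q: "f = weight_fun k q" "q \<noteq> 0"
        using E(1) unfolding inv_alg_ops(1)[OF assms] by blast
      \<comment> \<open>Splitting all factors \<open>x - d\<close> off an equation \<open>q\<close>
        of \<open>Z 1\<close> covers \<open>Z 1\<close> by two closed sets; the first misses the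
        point \<open>c\<close>, the second the point \<open>d\<close>.\<close>
      obtain g where g: "q = [:- d, 1:] ^ order d q * g" "poly g d \<noteq> 0"
        using order_decomp[OF q(2), of d] by (metis poly_eq_0_iff_dvd)
      let ?V = "\<lambda>h. {P \<in> spec ?R. {weight_fun k h} \<subseteq> P}"
      have V: "closedin ?X (?V h)" for h
        unfolding closedin_spec inv_alg_ops(1)[OF assms] by blast
      have "Z 1 \<subseteq> ?V [:- d, 1:] \<union> ?V g"
      proof
        fix M assume M: "M \<in> Z 1"
        obtain r where r: "M = weight_ideal k r"
          using points[OF M] by blast
        have "weight_fun k q \<in> weight_ideal k r"
          using M f(1) unfolding E(2) r q(1) by blast
        then have "poly q r = 0"
          by (simp add: in_weight)
        then have "r = d \<or> poly g r = 0"
          by (subst (asm) g(1)) auto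
        then show "M \<in> ?V [:- d, 1:] \<union> ?V g"
          using point by (auto simp: r in_weight)
      qed
      then have "Z 1 \<subseteq> ?V [:- d, 1:] \<or> Z 1 \<subseteq> ?V g"
        using irr(2) V unfolding irreducible_in_def by blast
      then show False
      proof
        assume "Z 1 \<subseteq> ?V [:- d, 1:]"
        then have "weight_fun k [:- d, 1:] \<in> weight_ideal k c"
          using P sub(1) cd(1) by blast
        then show False
          using \<open>c \<noteq> d\<close> by (simp add: in_weight)
      next
        assume "Z 1 \<subseteq> ?V g"
        then have "weight_fun k g \<in> weight_ideal k d"
          using Q(1) cd(2) by blast
        then show False
          using g(2) by (simp add: in_weight)
      qed
    qed
  qed
  have closed_pt: "closedin ?X {weight_ideal k 0}"
    unfolding closedin_spec
  proof (intro exI conjI)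
    show "{weight_fun k [:0, 1:]} \<subseteq> carrier ?R"
      by (simp add: inv_alg_ops[OF assms])
    show "{weight_ideal k 0} = {P \<in> spec ?R. {weight_fun k [:0, 1:]} \<subseteq> P}"
    proof (intro equalityI subsetI)
      fix P assume P: "P \<in> {P \<in> spec ?R. {weight_fun k [:0, 1:]} \<subseteq> P}"
      then have "primeideal P ?R"
        by (simp add: spec_def)
      then consider (zero) "P = {weight_fun k 0}" | (point) c where "P = weight_ideal k c"
        using primeideal_inv_alg_cases[OF assms] by metis
      then show "P \<in> {weight_ideal k 0}"
      proof cases
        case zero
        then show ?thesis
          using P by (simp add: weight_fun_inject[OF assms])
      next
        case (point c)
        then show ?thesis
          using P by (simp add: in_weight)
      qed
    qed (use point in \<open>auto simp: in_weight\<close>)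
  qed
  have closed_whole: "closedin ?X (spec ?R)"
    unfolding closedin_spec by (intro exI[of _ "{}"]) auto
  show "ereal (real 1) \<le> krull_dim ?X"
  proof (rule krull_dim_ge)
    let ?Z = "\<lambda>i::nat. if i = 0 then {weight_ideal k 0} else spec ?R"
    show "closedin ?X (?Z i)" for i
      using closed_pt closed_whole by simp
    have "irreducible_in ?X {weight_ideal k 0}"
      using closedin_subset[OF closed_pt] by (auto simp: irreducible_in_def)
    moreover have "irreducible_in ?X (spec ?R)"
      unfolding irreducible_in_def
    proof (intro conjI allI impI)
      fix A B assume AB: "closedin ?X A \<and> closedin ?X B \<and> spec ?R \<subseteq> A \<union> B"
      then show "spec ?R \<subseteq> A \<or> spec ?R \<subseteq> B"
        using whole[of A] whole[of B] gen by blast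
    qed (use gen topspace_spec in auto)
    ultimately show "irreducible_in ?X (?Z i)" for i
      by simp
    show "?Z i \<subset> ?Z (Suc i)" if "i < 1" for i
    proof -
      have "weight_fun k [:0, 1:] \<in> weight_ideal k 0" "weight_fun k [:0, 1:] \<notin> {weight_fun k 0}"
        by (simp_all add: in_weight weight_fun_inject[OF assms])
      then have "{weight_fun k 0} \<noteq> weight_ideal k 0"
        by blast
      then have "{weight_ideal k 0} \<subset> spec ?R"
        using gen point by blast
      then show ?thesis
        using that by simp
    qed
  qed
qed

theorem theorem4p3:
  fixes k :: nat
  assumes "k \<ge> 1"
  shows
    "is_polynomial_algebra (inv_alg k) (\<lambda>c. \<lambda>x\<in>jet_lie k. c)
   \<and> ((\<exists>x\<in>jet_lie k. dim_sub k (jet_orbit k x) = dim_lie k - dim_quot k) \<and>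
      (\<forall>x\<in>jet_lie k. dim_sub k (jet_orbit k x) \<le> dim_lie k - dim_quot k))
   \<and> (\<exists>d. \<forall>y\<in>closed_points (inv_alg k). dim_sub k (fibre k y) = d)
   \<and> (\<nexists>Z. prime_divisor k (jet_lie k) Z \<and> Z \<subseteq> jet_lie k - submersive_points k)
   \<and> (irreducible_in (zariski k (jet_lie k)) (null_cone k)
      \<and> complete_intersection k (jet_lie k) (null_cone k)
      \<and> dim_sub k (null_cone k) = dim_lie k - dim_quot k)"
proof -
  let ?X = "zariski k (jet_lie k)"
  have dim: "dim_lie k - dim_quot k = ereal (real (k - 1))"
    using assms by (simp add: dim_jet_lie dim_quot_eq[OF assms] of_nat_diff)
  have level: "dim_sub k {X \<in> jet_lie k. X $$ (0, 0) = c} = ereal (real (k - 1))" for c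
    unfolding level_set_eq_flat by (rule krull_dim_flat[OF assms])
  have null: "null_cone k = flat k {..<1} (\<lambda>_. 0)"
    by (simp only: null_cone_eq[OF assms] level_set_eq_flat)
  have B: "{..<1} \<subseteq> {..<k}"
    using assms by auto
  have null_dim: "dim_sub k (null_cone k) = ereal (real (k - 1))"
    unfolding null by (rule krull_dim_flat[OF assms])
  have orbit_max: "\<exists>x\<in>jet_lie k. dim_sub k (jet_orbit k x) = dim_lie k - dim_quot k"
    using jet_orbit_linear[OF assms] level[of 1] dim
    by (intro bexI[of _ "vf_mat k fps_X"]) (simp_all add: vf_mat_in_jet_lie)
  have orbit_le: "dim_sub k (jet_orbit k x) \<le> dim_lie k - dim_quot k" if "x \<in> jet_lie k" for x
    unfolding dim
    by (rule krull_dim_le_flat) (use jet_orbit_subset[OF assms that] in \<open>simp only: level_set_eq_flat\<close>)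
  have fibre_dim: "dim_sub k (fibre k y) = ereal (real (k - 1))" if "y \<in> closed_points (inv_alg k)" for y
    using closed_points_inv_alg[OF assms that] level by (metis fibre_weight_ideal[OF assms])
  \<comment> \<open>The complement of the submersive points is empty, while a prime divisor is
    nonempty by irreducibility.\<close>
  have no_divisor: "\<not> (prime_divisor k (jet_lie k) Z \<and> Z \<subseteq> jet_lie k - submersive_points k)" for Z
    by (auto simp: submersive_points_eq[OF assms] prime_divisor_def irreducible_in_def)
  have null_irr: "irreducible_in ?X (null_cone k)"
    unfolding null by (rule irreducible_in_flat[OF B])
  have null_ci: "complete_intersection k (jet_lie k) (null_cone k)"
    unfolding complete_intersection_def
  proof (intro conjI exI)
    show "closedin ?X (null_cone k)"
      unfolding null by (rule closedin_flat[OF B])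
    let ?F = "{\<lambda>X\<in>jet_lie k. X $$ (0, 0)}"
    show "finite ?F"
      by simp
    show "?F \<subseteq> coord_funs k (jet_lie k)"
      using entry_in_coord_funs[of 0 k 0] assms by simp
    \<comment> \<open>One equation matches the codimension \<open>k - (k - 1) = 1\<close>, where
      \<open>k \<ge> 1\<close> makes the natural subtraction exact.\<close>
    show "ereal (real (card ?F)) = dim_lie k - dim_sub k (null_cone k)"
      using assms by (simp add: null_dim dim_jet_lie of_nat_diff)
    show "vanishing_ideal k (jet_lie k) (null_cone k) =
        Idl\<^bsub>fun_alg (jet_lie k) (coord_funs k (jet_lie k))\<^esub> ?F"
      by (rule vanishing_ideal_null_cone[OF assms])
  qed
  show ?thesis
  proof (intro conjI ballI)
    show "\<exists>d. \<forall>y\<in>closed_points (inv_alg k). dim_sub k (fibre k y) = d"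
      using fibre_dim by blast
    show "\<nexists>Z. prime_divisor k (jet_lie k) Z \<and> Z \<subseteq> jet_lie k - submersive_points k"
      using no_divisor by blast
  qed (use is_polynomial_algebra_inv_alg[OF assms] orbit_max orbit_le null_irr null_ci null_dim dim
      in simp_all)
qed

end
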